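(* Under Assumptions 1 and 2 (stated in the context), $$\operatorname{epi}_\ge(J_{\mathrm{mix}})\subseteq\pi_{K,\gamma}(\mathcal{L}_{\mathrm{lft}})=\operatorname{cl}\,\operatorname{epi}_\ge(J_{\mathrm{mix}}),$$ where $\pi_{K,\gamma}(\mathcal{L}_{\mathrm{lft}}):=\{(K,\gamma):\exists X,\ (K,\gamma,X)\in\mathcal{L}_{\mathrm{lft}}\}$. Moreover, the map $\Phi(K,\gamma,X):=(\gamma,X,KX)$ is a $C^\infty$ (in particular $C^2$) diffeomorphism from $\mathcal{L}_{\mathrm{lft}}$ onto $\mathcal{F}_{\mathrm{cvx}}$.
   Context: Let $A\in\mathbb{R}^{n\times n}$, $B\in\mathbb{R}^{n\times m}$, $B_w\in\mathbb{R}^{n\times n}$, $W:=B_wB_w^{\mathsf T}$. Let $Q_2\succeq0$, $R_2\succ0$, $Q_\infty\succ0$, $R_\infty\succ0$ be symmetric weight matrices and $\beta>0$. For $K\in\mathbb{R}^{m\times n}$ write $A_K:=A+BK$, $S_K:=Q_\infty+K^{\mathsf T}R_\infty K$. Let $\mathcal{K}:=\{K: A_K \text{ Hurwitz}\}$, $\mathbf{T}_\infty(K)(s)=\begin{bmatrix}Q_\infty^{1/2}\\ R_\infty^{1/2}K\end{bmatrix}(sI-A_K)^{-1}B_w$, $\mathcal{K}_\beta:=\{K\in\mathcal{K}:\|\mathbf{T}_\infty(K)\|_{\mathcal{H}_\infty}<\beta\}$. For $K\in\mathcal{K}_\beta$ let $X_K$ be the unique stabilizing solution (i.e. $A_K+\beta^{-2}X_KS_K$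 Hurwitz) of $A_KX+XA_K^{\mathsf T}+\beta^{-2}XS_KX+W=0$ and $J_{\mathrm{mix}}(K):=\operatorname{tr}((Q_2+K^{\mathsf T}R_2K)X_K)$. $\operatorname{epi}_\ge(J_{\mathrm{mix}}):=\{(K,\gamma)\in\mathcal{K}_\beta\times\mathbb{R}:\gamma\ge J_{\mathrm{mix}}(K)\}$ and $\operatorname{cl}$ denotes closure in $\mathbb{R}^{m\times n}\times\mathbb{R}$. Lifted set: $\mathcal{L}_{\mathrm{lft}}:=\{(K,\gamma,X): K\in\mathbb{R}^{m\times n},\gamma\in\mathbb{R},X\succ0,\ \gamma\ge\operatorname{tr}(Q_2X)+\operatorname{tr}(R_2KXK^{\mathsf T}),\ A_KX+XA_K^{\mathsf T}+\beta^{-2}XS_KX+W\preceq0\}$. Convex set: $\mathcal{F}_{\mathrm{cvx}}:=\{(\gamma,X,Y):\gamma\in\mathbb{R},X\succ0,Y\in\mathbb{R}^{m\times n},\ \mathbb{F}_{\mathrm{cvx}}(X,Y)\preceq0,\ \gamma\ge\operatorname{tr}(Q_2X)+\operatorname{tr}(R_2YX^{-1}Y^{\mathsf T})\}$, where $\mathbb{F}_{\mathrm{cvx}}(X,Y):=\begin{bmatrix}AX+XA^{\mathsf T}+BY+Y^{\mathsf T}B^{\mathsf T}+W & XQ_\infty^{1/2} & Y^{\mathsf T}R_\infty^{1/2}\\ Q_\infty^{1/2}X & -\beta^2I & 0\\ R_\infty^{1/2}Y & 0 & -\beta^2I\end{bmatrix}$. Assumption 1: $(A,B)$ stabilizable,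 $(Q_2^{1/2},A)$ detectable, and $\beta>\inf_{K\in\mathcal{K}}\|\mathbf{T}_\infty(K)\|_{\mathcal{H}_\infty}$. Assumption 2: $Q_2\succeq0$ and $W,Q_\infty,R_2,R_\infty$ positive definite. *)

theory Defs
  imports "HOL-Analysis.Analysis"
begin

definition psd :: "real^'n^'n \<Rightarrow> bool" where
  "psd M \<longleftrightarrow> transpose M = M \<and> (\<forall>x. 0 \<le> x \<bullet> (M *v x))"

definition pd :: "real^'n^'n \<Rightarrow> bool" where
  "pd M \<longleftrightarrow> transpose M = M \<and> (\<forall>x. x \<noteq> 0 \<longrightarrow> 0 < x \<bullet> (M *v x))"

definition nsd :: "real^'n^'n \<Rightarrow> bool" where
  "nsd M \<longleftrightarrow> psd (- M)"

definition msqrt :: "real^'n^'n \<Rightarrow> real^'n^'n" where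
  "msqrt Q = (THE S. psd S \<and> S ** S = Q)"

definition cmat :: "real^'q^'p \<Rightarrow> complex^'q^'p" where
  "cmat A = (\<chi> i j. complex_of_real (A $ i $ j))"

definition hurwitz :: "real^'n^'n \<Rightarrow> bool" where
  "hurwitz A \<longleftrightarrow> (\<forall>z::complex. det (mat z - cmat A) = 0 \<longrightarrow> Re z < 0)"

definition AK :: "real^'n^'n \<Rightarrow> real^'m^'n \<Rightarrow> real^'n^'m \<Rightarrow> real^'n^'n" where
  "AK A B K = A + B ** K"

definition SK :: "real^'n^'n \<Rightarrow> real^'m^'m \<Rightarrow> real^'n^'m \<Rightarrow> real^'n^'n" where
  "SK Qinf Rinf K = Qinf + transpose K ** Rinf ** K"

definition Tinf ::
  "real^'n^'n \<Rightarrow> real^'m^'n \<Rightarrow> real^'n^'n \<Rightarrow> real^'n^'n \<Rightarrow> real^'m^'m \<Rightarrow> real^'n^'m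
   \<Rightarrow> complex \<Rightarrow> complex^'n^('n + 'm)" where
  "Tinf A B Bw Qinf Rinf K s =
     (\<chi> i j. case i of Inl a \<Rightarrow> cmat (msqrt Qinf) $ a $ j
                     | Inr b \<Rightarrow> cmat (msqrt Rinf ** K) $ b $ j)
     ** matrix_inv (mat s - cmat (AK A B K)) ** cmat Bw"

text \<open>H-infinity norm: supremum over the imaginary axis of the largest singular value
  (= induced Euclidean operator norm).\<close>
definition hinf_norm ::
  "real^'n^'n \<Rightarrow> real^'m^'n \<Rightarrow> real^'n^'n \<Rightarrow> real^'n^'n \<Rightarrow> real^'m^'m \<Rightarrow> real^'n^'m \<Rightarrow> real" where
  "hinf_norm A B Bw Qinf Rinf K =
     (SUP \<omega>::real. onorm (\<lambda>v. Tinf A B Bw Qinf Rinf K (\<i> * complex_of_real \<omega>) *v v))"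

definition Kstab :: "real^'n^'n \<Rightarrow> real^'m^'n \<Rightarrow> (real^'n^'m) set" where
  "Kstab A B = {K. hurwitz (AK A B K)}"

definition Kbeta ::
  "real^'n^'n \<Rightarrow> real^'m^'n \<Rightarrow> real^'n^'n \<Rightarrow> real^'n^'n \<Rightarrow> real^'m^'m \<Rightarrow> real \<Rightarrow> (real^'n^'m) set" where
  "Kbeta A B Bw Qinf Rinf \<beta> = {K \<in> Kstab A B. hinf_norm A B Bw Qinf Rinf K < \<beta>}"

definition ric ::
  "real^'n^'n \<Rightarrow> real^'m^'n \<Rightarrow> real^'n^'n \<Rightarrow> real^'n^'n \<Rightarrow> real^'m^'m \<Rightarrow> real
   \<Rightarrow> real^'n^'m \<Rightarrow> real^'n^'n \<Rightarrow> real^'n^'n" where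
  "ric A B Bw Qinf Rinf \<beta> K X =
     AK A B K ** X + X ** transpose (AK A B K) + (inverse (\<beta>^2)) *\<^sub>R (X ** SK Qinf Rinf K ** X)
     + Bw ** transpose Bw"

definition XK ::
  "real^'n^'n \<Rightarrow> real^'m^'n \<Rightarrow> real^'n^'n \<Rightarrow> real^'n^'n \<Rightarrow> real^'m^'m \<Rightarrow> real
   \<Rightarrow> real^'n^'m \<Rightarrow> real^'n^'n" where
  "XK A B Bw Qinf Rinf \<beta> K =
     (THE X. transpose X = X \<and> ric A B Bw Qinf Rinf \<beta> K X = 0
        \<and> hurwitz (AK A B K + (inverse (\<beta>^2)) *\<^sub>R (X ** SK Qinf Rinf K)))"

definition Jmix ::
  "real^'n^'n \<Rightarrow> real^'m^'n \<Rightarrow> real^'n^'n \<Rightarrow> real^'n^'n \<Rightarrow> real^'m^'m \<Rightarrow> real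
   \<Rightarrow> real^'n^'n \<Rightarrow> real^'m^'m \<Rightarrow> real^'n^'m \<Rightarrow> real" where
  "Jmix A B Bw Qinf Rinf \<beta> Q2 R2 K =
     trace ((Q2 + transpose K ** R2 ** K) ** XK A B Bw Qinf Rinf \<beta> K)"

definition epi_Jmix ::
  "real^'n^'n \<Rightarrow> real^'m^'n \<Rightarrow> real^'n^'n \<Rightarrow> real^'n^'n \<Rightarrow> real^'m^'m \<Rightarrow> real
   \<Rightarrow> real^'n^'n \<Rightarrow> real^'m^'m \<Rightarrow> ((real^'n^'m) \<times> real) set" where
  "epi_Jmix A B Bw Qinf Rinf \<beta> Q2 R2 =
     {(K, \<gamma>). K \<in> Kbeta A B Bw Qinf Rinf \<beta> \<and> \<gamma> \<ge> Jmix A B Bw Qinf Rinf \<beta> Q2 R2 K}"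

definition Llft ::
  "real^'n^'n \<Rightarrow> real^'m^'n \<Rightarrow> real^'n^'n \<Rightarrow> real^'n^'n \<Rightarrow> real^'m^'m \<Rightarrow> real
   \<Rightarrow> real^'n^'n \<Rightarrow> real^'m^'m \<Rightarrow> ((real^'n^'m) \<times> real \<times> (real^'n^'n)) set" where
  "Llft A B Bw Qinf Rinf \<beta> Q2 R2 =
     {(K, \<gamma>, X). pd X
        \<and> \<gamma> \<ge> trace (Q2 ** X) + trace (R2 ** K ** X ** transpose K)
        \<and> nsd (ric A B Bw Qinf Rinf \<beta> K X)}"

definition proj_Kgamma :: "('k \<times> 'g \<times> 'x) set \<Rightarrow> ('k \<times> 'g) set" where
  "proj_Kgamma L = {(K, \<gamma>). \<exists>X. (K, \<gamma>, X) \<in> L}"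

definition Fcvx_mat ::
  "real^'n^'n \<Rightarrow> real^'m^'n \<Rightarrow> real^'n^'n \<Rightarrow> real^'n^'n \<Rightarrow> real^'m^'m \<Rightarrow> real
   \<Rightarrow> real^'n^'n \<Rightarrow> real^'n^'m \<Rightarrow> real^('n + ('n + 'm))^('n + ('n + 'm))" where
  "Fcvx_mat A B Bw Qinf Rinf \<beta> X Y =
    (let M11 = A ** X + X ** transpose A + B ** Y + transpose Y ** transpose B + Bw ** transpose Bw;
         M12 = X ** msqrt Qinf;
         M13 = transpose Y ** msqrt Rinf;
         M21 = msqrt Qinf ** X;
         M31 = msqrt Rinf ** Y
     in (\<chi> i j. case (i, j) of
           (Inl a, Inl b) \<Rightarrow> M11 $ a $ b
         | (Inl a, Inr (Inl b)) \<Rightarrow> M12 $ a $ b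
         | (Inl a, Inr (Inr b)) \<Rightarrow> M13 $ a $ b
         | (Inr (Inl a), Inl b) \<Rightarrow> M21 $ a $ b
         | (Inr (Inl a), Inr (Inl b)) \<Rightarrow> (if a = b then - (\<beta>^2) else 0)
         | (Inr (Inl a), Inr (Inr b)) \<Rightarrow> 0
         | (Inr (Inr a), Inl b) \<Rightarrow> M31 $ a $ b
         | (Inr (Inr a), Inr (Inl b)) \<Rightarrow> 0
         | (Inr (Inr a), Inr (Inr b)) \<Rightarrow> (if a = b then - (\<beta>^2) else 0)))"

definition Fcvx ::
  "real^'n^'n \<Rightarrow> real^'m^'n \<Rightarrow> real^'n^'n \<Rightarrow> real^'n^'n \<Rightarrow> real^'m^'m \<Rightarrow> real
   \<Rightarrow> real^'n^'n \<Rightarrow> real^'m^'m \<Rightarrow> (real \<times> (real^'n^'n) \<times> (real^'n^'m)) set" where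
  "Fcvx A B Bw Qinf Rinf \<beta> Q2 R2 =
     {(\<gamma>, X, Y). pd X \<and> nsd (Fcvx_mat A B Bw Qinf Rinf \<beta> X Y)
        \<and> \<gamma> \<ge> trace (Q2 ** X) + trace (R2 ** Y ** matrix_inv X ** transpose Y)}"

text \<open>C^k on a set S (intended for open S): continuous for k = 0; for k+1, differentiable
  with every directional derivative x \<mapsto> Df(x) h of class C^k (finite-dimensional setting).\<close>
fun Ck :: "nat \<Rightarrow> 'a::real_normed_vector set \<Rightarrow> ('a \<Rightarrow> 'b::real_normed_vector) \<Rightarrow> bool" where
  "Ck 0 S f = continuous_on S f"
| "Ck (Suc k) S f = (f differentiable_on S \<and>
      (\<forall>h. Ck k S (\<lambda>x. frechet_derivative f (at x) h)))"

definition smooth_on :: "'a::real_normed_vector set \<Rightarrow> ('a \<Rightarrow> 'b::real_normed_vector) \<Rightarrow> bool" where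
  "smooth_on S f \<longleftrightarrow> (\<forall>k. Ck k S f)"

definition smooth_ext :: "'a::real_normed_vector set \<Rightarrow> ('a \<Rightarrow> 'b::real_normed_vector) \<Rightarrow> bool" where
  "smooth_ext T f \<longleftrightarrow> (\<exists>U g. open U \<and> T \<subseteq> U \<and> smooth_on U g \<and> (\<forall>x\<in>T. g x = f x))"

definition smooth_diffeo ::
  "('a::real_normed_vector \<Rightarrow> 'b::real_normed_vector) \<Rightarrow> 'a set \<Rightarrow> 'b set \<Rightarrow> bool" where
  "smooth_diffeo \<Phi> S T \<longleftrightarrow> bij_betw \<Phi> S T \<and> smooth_ext S \<Phi> \<and> smooth_ext T (inv_into S \<Phi>)"

end

(* The paper's objects are handled through quadratic forms. A Hurwitz matrix M has a positive
   definite Lyapunov certificate D (MD + DM^T < 0), and conversely.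

   For the Riccati map F_t(X) = AX + XA^T + tXSX + W: a strict subsolution Y (F_t(Y) < 0) dominates
   a stabilizing solution, every stabilizing solution lies below all subsolutions, and a stabilizing
   solution can be pushed to a strict subsolution. Hence the set of t admitting a stabilizing solution
   is open; below the H-infinity threshold t = beta^-2 it is also closed, because the limit closed loop
   can have no imaginary eigenvalue (the associated frequency would violate the gain bound) and no
   eigenvalue in the open right half plane (the solutions increase to their limit). So K_beta consists
   of exactly those K for which ric K X < 0 has a positive definite solution X, and X_K is the least
   solution of ric K X <= 0.

   The first inclusion takes X = X_K. Since XSX dominates the linear terms, X stays bounded when K
   does, so the projection is closed. In the variables (X, KX) the lifted set is convex; mixing a point
   of it with a strictly feasible one produces strictly feasible points converging to it, which gives
   density. The diffeomorphism is a Schur complement together with smoothness of matrix inversion. *)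

theory Submission
  imports Defs "HOL-Computational_Algebra.Fundamental_Theorem_Algebra"
begin

section \<open>Quadratic forms\<close>

text \<open>A stabilizing solution at t = beta^-2 has to be produced from a bound on frequency
  responses. It is reached by continuation in t from t = 0, where the equation is linear. The same
  existence result, with other data, also yields matrix square roots. In the other direction the
  obstacle is strictness. A point of the lifted set satisfies only a non-strict inequality and its K
  need not lie in K_beta, while K_beta demands a strict bound on a supremum over all frequencies.
  Slack in ric K X < 0 allows W to be enlarged by a factor 1 + d, which yields one bound below beta
  valid at every frequency. Definiteness of W does two jobs: it forces every psd subsolution to be
  positive definite, and it turns a nonzero left eigenvector into a nonzero input. Definiteness of
  S_K bounds all subsolutions, and so gives the compactness behind the limits in t and in K. Complex
  eigenvectors and responses are handled as pairs of real vectors. Adding a symmetric form over both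
  members of the pair cancels the terms that carry the frequency.\<close>

abbreviation qf :: "real^'n^'n \<Rightarrow> real^'n \<Rightarrow> real" where
  "qf M x \<equiv> x \<bullet> (M *v x)"

text \<open>The transposes are placed as in the linear part of the Riccati equation. For symmetric D
  the form is then \<open>2 * ((x v* M) \<bullet> (D *v x))\<close>, so left eigenvectors of M are
  the vectors to test with.\<close>

definition lyap :: "real^'n^'n \<Rightarrow> real^'n^'n \<Rightarrow> real^'n^'n" where
  "lyap M D = M ** D + D ** transpose M"

text \<open>The coefficient t is a separate argument because it is the continuation parameter, with
  final value \<open>inverse (\<beta>^2)\<close>. W is free so that it can be scaled to create
  slack.\<close>

definition riccati :: "real^'n^'n \<Rightarrow> real^'n^'n \<Rightarrow> real \<Rightarrow> real^'n^'n \<Rightarrow> real^'n^'n \<Rightarrow> real^'n^'n" where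
  "riccati A S t W X = A ** X + X ** transpose A + t *\<^sub>R (X ** S ** X) + W"

section \<open>Algebra of real matrices and their forms\<close>

lemma scaleR_matrix_mul_left: "(k *\<^sub>R A) ** B = k *\<^sub>R (A ** B)" for A :: "real^'n^'m" and B :: "real^'p^'n"
  by (simp only: scalar_matrix_assoc)

lemma scaleR_matrix_mul_right: "A ** (k *\<^sub>R B) = k *\<^sub>R (A ** B)" for A :: "real^'n^'m" and B :: "real^'p^'n"
  by (simp only: matrix_scalar_ac scaleR_matrix_mul_left)

lemma scaleR_matrix_vector: "(k *\<^sub>R A) *v x = k *\<^sub>R (A *v x)" for A :: "real^'n^'m"
  by (simp only: scaleR_matrix_vector_assoc)

lemma minus_matrix_vector: "(- A) *v x = - (A *v x)" for A :: "real^'n^'m"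
  by (metis (no_types) diff_0 matrix_vector_mult_0 matrix_vector_mult_diff_rdistrib)

lemma matrix_vector_neg: "A *v (- x) = - (A *v x)" for A :: "real^'n^'m"
  by (metis (no_types) diff_0 matrix_vector_mult_0_right matrix_vector_mult_diff_distrib)

lemma transpose_add: "transpose (A + B) = transpose A + transpose B"
  by (simp add: transpose_def vec_eq_iff)

lemma transpose_diff: "transpose (A - B) = transpose A - transpose B"
  by (simp add: transpose_def vec_eq_iff)

lemma transpose_minus: "transpose (- A) = - transpose A"
  by (simp add: transpose_def vec_eq_iff)

lemma transpose_zero [simp]: "transpose 0 = 0"
  by (simp add: transpose_def vec_eq_iff)

lemma matrix_mul_minus_left: "(- A) ** B = - (A ** B)" for A :: "'a::ring_1^'n^'m"
  by (simp add: matrix_matrix_mult_def vec_eq_iff sum_negf)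

lemma matrix_mul_minus_right: "A ** (- B) = - (A ** B)" for A :: "'a::ring_1^'n^'m"
  by (simp add: matrix_matrix_mult_def vec_eq_iff sum_negf)

lemma matrix_mul_add_left: "(A + B) ** C = A ** C + B ** C" for A :: "'a::ring_1^'n^'m"
  by (simp add: matrix_matrix_mult_def vec_eq_iff sum.distrib distrib_right)

lemma matrix_mul_diff_left: "(A - B) ** C = A ** C - B ** C" for A :: "'a::ring_1^'n^'m"
  by (simp add: matrix_matrix_mult_def vec_eq_iff sum_subtractf left_diff_distrib)

lemma matrix_mul_diff_right: "A ** (B - C) = A ** B - A ** C" for A :: "'a::ring_1^'n^'m"
  by (simp add: matrix_matrix_mult_def vec_eq_iff sum_subtractf right_diff_distrib)

lemmas mat_distribs = matrix_add_ldistrib matrix_mul_add_left matrix_mul_minus_left matrix_mul_minus_right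
  matrix_mul_diff_left matrix_mul_diff_right scaleR_matrix_mul_left scaleR_matrix_mul_right
  transpose_add transpose_diff transpose_minus transpose_scalar

lemmas mv_distribs = scaleR_matrix_vector minus_matrix_vector matrix_vector_neg
  matrix_vector_mult_add_rdistrib matrix_vector_mult_diff_rdistrib
  matrix_vector_right_distrib matrix_vector_mult_diff_distrib matrix_vector_mult_scaleR

lemma symmetric_vector_matrix: "transpose M = M \<Longrightarrow> x v* M = M *v x" for M :: "real^'n^'n"
  by (metis transpose_matrix_vector)

lemma symmetric_dot:
  fixes M :: "real^'n^'n"
  assumes "transpose M = M"
  shows "x \<bullet> (M *v y) = y \<bullet> (M *v x)"
  using dot_lmul_matrix[of x M y] by (simp add: symmetric_vector_matrix[OF assms] inner_commute)

lemma dot_transpose: "x \<bullet> (y v* M) = (M *v x) \<bullet> y" for M :: "real^'n^'m"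
  by (metis dot_lmul_matrix inner_commute)

lemma qf_add: "qf (M + N) x = qf M x + qf N x"
  and qf_diff: "qf (M - N) x = qf M x - qf N x"
  and qf_minus: "qf (- M) x = - qf M x"
  and qf_scaleR: "qf (k *\<^sub>R M) x = k * qf M x"
  by (simp_all add: mv_distribs inner_add_right inner_diff_right)

lemma qf_scaleR_vec: "qf M (k *\<^sub>R x) = k^2 * qf M x"
  by (simp add: mv_distribs power2_eq_square)

lemma qf_gram: "qf (B ** transpose B) x = (x v* B) \<bullet> (x v* B)"
  by (simp add: matrix_vector_mul_assoc [symmetric] dot_lmul_matrix [symmetric])

lemma qf_lyap:
  assumes "transpose D = D"
  shows "qf (lyap M D) x = 2 * ((x v* M) \<bullet> (D *v x))"
proof -
  have "x \<bullet> (D *v (x v* M)) = (x v* M) \<bullet> (D *v x)"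
    by (rule symmetric_dot[OF assms])
  then show ?thesis
    by (simp add: lyap_def matrix_vector_mult_add_rdistrib inner_add_right
        matrix_vector_mul_assoc [symmetric] dot_lmul_matrix)
qed

lemma qf_riccati:
  assumes "transpose X = X"
  shows "qf (riccati A S t W X) x = 2 * ((x v* A) \<bullet> (X *v x)) + t * qf S (X *v x) + qf W x"
proof -
  have "x \<bullet> (X *v (S *v (X *v x))) = qf S (X *v x)"
    by (metis dot_lmul_matrix symmetric_vector_matrix[OF assms])
  then show ?thesis
    using qf_lyap[OF assms, where x = x and M = A]
    by (simp add: riccati_def lyap_def qf_add qf_scaleR matrix_vector_mul_assoc [symmetric])
qed

lemma lyap_linear: "linear (lyap M)"
  by (rule linearI) (simp_all add: lyap_def mat_distribs algebra_simps)

lemma lyap_add: "lyap M (D + E) = lyap M D + lyap M E"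
  and lyap_diff: "lyap M (D - E) = lyap M D - lyap M E"
  and lyap_scaleR: "lyap M (k *\<^sub>R D) = k *\<^sub>R lyap M D"
  using lyap_linear[of M] by (auto simp: linear_add linear_diff linear_scale)

lemma transpose_lyap: "transpose (lyap M D) = lyap M (transpose D)"
  by (simp add: lyap_def mat_distribs matrix_transpose_mul add.commute)

lemma transpose_riccati:
  "transpose X = X \<Longrightarrow> transpose S = S \<Longrightarrow> transpose W = W \<Longrightarrow>
    transpose (riccati A S t W X) = riccati A S t W X"
  by (simp add: riccati_def mat_distribs matrix_transpose_mul add.commute matrix_mul_assoc)

text \<open>The map is quadratic, so its expansion at X is exact. The linear term is the Lyapunov
  operator of the closed loop at X, and for psd S, t >= 0 and symmetric Y the remainder is psd. The
  comparisons of solutions rest on this identity.\<close>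

lemma riccati_diff:
  assumes "transpose X = X" "transpose S = S"
  shows "riccati A S t W Y - riccati A S t W X
    = lyap (A + t *\<^sub>R (X ** S)) (Y - X) + t *\<^sub>R ((Y - X) ** S ** (Y - X))"
  using assms
  by (simp add: riccati_def lyap_def mat_distribs matrix_transpose_mul matrix_mul_assoc algebra_simps)

lemma qf_sandwich: "transpose E = E \<Longrightarrow> qf (E ** S ** E) x = qf S (E *v x)"
  by (simp add: matrix_vector_mul_assoc [symmetric]) (metis dot_lmul_matrix symmetric_vector_matrix)

section \<open>Semidefinite matrices\<close>

lemma psd_sym: "psd M \<Longrightarrow> transpose M = M"
  and psd_qf: "psd M \<Longrightarrow> 0 \<le> qf M x"
  and pd_sym: "pd M \<Longrightarrow> transpose M = M"
  and pd_qf: "pd M \<Longrightarrow> x \<noteq> 0 \<Longrightarrow> 0 < qf M x"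
  by (auto simp: psd_def pd_def)

lemma pd_imp_psd: "pd M \<Longrightarrow> psd M"
  unfolding psd_def pd_def by (metis inner_zero_left less_eq_real_def)

lemma pd_imp_invertible: "pd M \<Longrightarrow> invertible M"
  by (metis invertible_left_inverse matrix_left_invertible_ker pd_qf inner_zero_right less_irrefl)

lemma psd_polar:
  assumes "transpose M = M"
  shows "qf M (x + s *\<^sub>R y) = qf M x + 2 * s * (y \<bullet> (M *v x)) + s^2 * qf M y"
  by (simp add: mv_distribs inner_add_right inner_add_left power2_eq_square algebra_simps
      symmetric_dot[OF assms, of x y])

lemma psd_kernel:
  assumes "psd M" "qf M x = 0"
  shows "M *v x = 0"
proof (rule ccontr)
  let ?y = "M *v x"
  assume ne: "?y \<noteq> 0"
  define c where "c = qf M ?y"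
  \<comment> \<open>Moving from x against Mx, the form is negative to first order. This s is small
    enough for the quadratic term not to compensate, and the + 1 covers c = 0.\<close>
  define s where "s = - (?y \<bullet> ?y) / (c + 1)"
  have c: "c \<ge> 0" using assms(1) c_def psd_qf by blast
  have "0 \<le> qf M (x + s *\<^sub>R ?y)" using assms(1) psd_qf by blast
  also have "\<dots> = s * (2 * (?y \<bullet> ?y) + s * c)"
    using assms(2) unfolding psd_polar[OF psd_sym[OF assms(1)]] c_def
    by (simp add: power2_eq_square algebra_simps)
  also have "2 * (?y \<bullet> ?y) + s * c = (?y \<bullet> ?y) * (2 - c / (c + 1))"
    by (simp add: s_def algebra_simps)
  also have "s * \<dots> < 0"
  proof -
    have y: "?y \<bullet> ?y > 0" using ne by simp
    have "c / (c + 1) < 2" using c by (simp add: field_simps)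
    with y have "(?y \<bullet> ?y) * (2 - c / (c + 1)) > 0" by simp
    moreover have "s < 0" unfolding s_def using y c by (simp add: divide_neg_pos)
    ultimately show ?thesis by (rule mult_neg_pos[rotated])
  qed
  finally show False by simp
qed

lemma symmetric_eq_zero:
  assumes "transpose M = M" "\<And>x. qf M x = 0"
  shows "M = 0"
proof -
  have "psd M" using assms by (simp add: psd_def)
  then have "M *v x = 0" for x using assms(2) psd_kernel by blast
  then show ?thesis by (simp add: matrix_eq)
qed

lemma continuous_qf [continuous_intros]:
  "continuous_on S f \<Longrightarrow> continuous_on S (\<lambda>x. qf M (f x))"
  by (intro continuous_intros matrix_vector_mult_linear_continuous_on[THEN continuous_on_compose2]) auto

lemma pd_lower:
  assumes "pd M"
  obtains c where "c > 0" "\<And>x. c * (x \<bullet> x) \<le> qf M x"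
proof -
  have "compact (sphere 0 1 :: (real^'n) set)" by simp
  moreover have "(sphere 0 1 :: (real^'n) set) \<noteq> {}" by simp
  moreover have "continuous_on (sphere 0 1) (qf M)" by (intro continuous_intros)
  ultimately have "\<exists>v\<in>sphere 0 1. \<forall>y\<in>sphere 0 1. qf M v \<le> qf M y"
    by (rule continuous_attains_inf)
  then obtain v where v: "v \<in> sphere 0 1" "\<And>y. y \<in> sphere 0 1 \<Longrightarrow> qf M v \<le> qf M y"
    by blast
  show ?thesis
  proof
    show "qf M v > 0" using v(1) assms pd_qf[of M v] by fastforce
    fix x
    show "qf M v * (x \<bullet> x) \<le> qf M x"
    proof (cases "x = 0")
      case False
      have "qf M v \<le> qf M ((1 / norm x) *\<^sub>R x)" by (rule v(2)) (use False in auto)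
      also have "\<dots> = (1 / norm x)^2 * qf M x" by (rule qf_scaleR_vec)
      finally show ?thesis using False
        by (simp add: power_one_over field_simps power2_norm_eq_inner)
    qed simp
  qed
qed

text \<open>The norm of a matrix is here the Frobenius norm, which dominates the operator
  norm.\<close>

lemma matrix_vector_norm_bound:
  fixes M :: "real^'n^'m"
  shows "norm (M *v x) \<le> norm M * norm x"
proof -
  have "norm (M *v x) = L2_set (\<lambda>i. norm (M $ i \<bullet> x)) UNIV"
    by (simp add: norm_vec_def matrix_vector_mul_component inner_commute)
  also have "\<dots> \<le> L2_set (\<lambda>i. norm (M $ i) * norm x) UNIV"
    by (intro L2_set_mono Cauchy_Schwarz_ineq2) (auto simp: Cauchy_Schwarz_ineq2)
  also have "\<dots> = norm M * norm x" by (simp add: norm_vec_def L2_set_left_distrib)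
  finally show ?thesis .
qed

lemma qf_norm_bound: "\<bar>qf M x\<bar> \<le> norm M * (x \<bullet> x)"
proof -
  have "\<bar>qf M x\<bar> \<le> norm x * norm (M *v x)" by (rule Cauchy_Schwarz_ineq2)
  also have "\<dots> \<le> norm x * (norm M * norm x)" by (intro mult_left_mono matrix_vector_norm_bound) auto
  finally show ?thesis by (simp add: dot_square_norm power2_eq_square mult_ac)
qed

lemma psd_trace_nonneg: "psd M \<Longrightarrow> trace M \<ge> 0"
  and psd_trace_zero: "psd M \<Longrightarrow> trace M = 0 \<Longrightarrow> M = 0"
proof -
  have d: "M $ i $ i = qf M (axis i 1)" for i
    by (simp add: matrix_vector_mul_component inner_axis inner_axis_axis matrix_vector_mult_basis column_def inner_commute[of "axis i 1"])
  assume M: "psd M"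
  show "trace M \<ge> 0" unfolding trace_def d by (intro sum_nonneg psd_qf M)
  assume "trace M = 0"
  then have "qf M (axis i 1) = 0" for i
    unfolding trace_def d using M psd_qf by (subst (asm) sum_nonneg_eq_0_iff) auto
  then have "M *v axis i 1 = 0" for i using M psd_kernel by blast
  then show "M = 0" by (simp add: matrix_vector_mult_basis column_def vec_eq_iff)
qed

section \<open>Hurwitz matrices\<close>

text \<open>Splitting a complex vector into real and imaginary parts lets real quadratic forms test
  complex eigenvectors and frequency responses.\<close>

definition cvec :: "real^'n \<Rightarrow> real^'n \<Rightarrow> complex^'n" where
  "cvec a b = (\<chi> i. Complex (a $ i) (b $ i))"

lemma cvec_cases: obtains a b where "w = cvec a b"
proof
  show "w = cvec (\<chi> i. Re (w $ i)) (\<chi> i. Im (w $ i))" by (simp add: cvec_def vec_eq_iff)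
qed

lemma cvec_eq_iff: "cvec a b = cvec c d \<longleftrightarrow> a = c \<and> b = d"
  by (auto simp: cvec_def vec_eq_iff)

lemma cvec_0: "cvec 0 0 = 0"
  by (simp add: cvec_def vec_eq_iff complex_eq_iff)

lemma cvec_eq_0_iff: "cvec a b = 0 \<longleftrightarrow> a = 0 \<and> b = 0"
  using cvec_eq_iff[of a b 0 0] by (simp add: cvec_0)

lemma cmat_mult_cvec: "cmat M *v cvec a b = cvec (M *v a) (M *v b)"
  by (simp add: cmat_def cvec_def vec_eq_iff matrix_vector_mult_def complex_eq_iff)

lemma cmat_transpose: "transpose (cmat M) = cmat (transpose M)"
  by (simp add: cmat_def transpose_def vec_eq_iff)

lemma mat_mult_vec: "mat z *v w = (\<chi> i. z * w $ i)" for w :: "'a::semiring_1^'n"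
  by (simp add: mat_def matrix_vector_mult_def vec_eq_iff if_distrib if_distribR cong: if_cong)

lemma mat_mult_cvec:
  "mat z *v cvec a b = cvec (Re z *\<^sub>R a - Im z *\<^sub>R b) (Im z *\<^sub>R a + Re z *\<^sub>R b)"
  by (simp add: mat_mult_vec cvec_def vec_eq_iff complex_eq_iff)

lemma norm_cvec: "(norm (cvec a b))\<^sup>2 = a \<bullet> a + b \<bullet> b"
proof -
  have "(norm (cvec a b))\<^sup>2 = (\<Sum>i\<in>UNIV. (cmod (Complex (a $ i) (b $ i)))\<^sup>2)"
    by (simp add: norm_vec_def L2_set_def sum_nonneg cvec_def)
  also have "\<dots> = (\<Sum>i\<in>UNIV. (a $ i)\<^sup>2 + (b $ i)\<^sup>2)"
    by (simp add: cmod_power2)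
  finally show ?thesis
    by (simp add: sum.distrib inner_vec_def power2_eq_square)
qed

lemma det_eq_0_iff: "det M = 0 \<longleftrightarrow> (\<exists>x. x \<noteq> 0 \<and> M *v x = 0)" for M :: "'a::field^'n^'n"
  by (metis invertible_det_nz invertible_left_inverse matrix_left_invertible_ker)

lemma char_root_iff:
  "det (mat z - cmat M) = 0 \<longleftrightarrow>
    (\<exists>a b. (a \<noteq> 0 \<or> b \<noteq> 0) \<and> M *v a = Re z *\<^sub>R a - Im z *\<^sub>R b \<and> M *v b = Im z *\<^sub>R a + Re z *\<^sub>R b)"
proof -
  have "(mat z - cmat M) *v cvec a b = 0 \<longleftrightarrow>
      M *v a = Re z *\<^sub>R a - Im z *\<^sub>R b \<and> M *v b = Im z *\<^sub>R a + Re z *\<^sub>R b" for a b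
    by (simp add: matrix_vector_mult_diff_rdistrib mat_mult_cvec cmat_mult_cvec cvec_eq_iff) metis
  then show ?thesis
    unfolding det_eq_0_iff by (metis cvec_cases cvec_eq_0_iff)
qed

lemma char_root_transpose: "det (mat z - cmat (transpose M)) = det (mat z - cmat M)"
proof -
  have "mat z - cmat (transpose M) = transpose (mat z - cmat M)"
    by (simp add: cmat_transpose vec_eq_iff transpose_def mat_def cmat_def)
  then show ?thesis by (simp add: det_transpose)
qed

lemma left_char_root_iff:
  "det (mat z - cmat M) = 0 \<longleftrightarrow>
    (\<exists>a b. (a \<noteq> 0 \<or> b \<noteq> 0) \<and> a v* M = Re z *\<^sub>R a - Im z *\<^sub>R b \<and> b v* M = Im z *\<^sub>R a + Re z *\<^sub>R b)"
  using char_root_iff[of z "transpose M"] unfolding char_root_transpose by simp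

text \<open>The two equations are the real and imaginary parts of the left eigenvector equation for
  a + ib with eigenvalue s + iw.\<close>

lemma hurwitzD_left:
  assumes "hurwitz M" "a \<noteq> 0 \<or> b \<noteq> 0" "a v* M = s *\<^sub>R a - w *\<^sub>R b" "b v* M = w *\<^sub>R a + s *\<^sub>R b"
  shows "s < 0"
  using assms left_char_root_iff[of "Complex s w" M] unfolding hurwitz_def by force

lemma hurwitzI_left:
  assumes "\<And>a b s w. a \<noteq> 0 \<or> b \<noteq> 0 \<Longrightarrow> a v* M = s *\<^sub>R a - w *\<^sub>R b \<Longrightarrow> b v* M = w *\<^sub>R a + s *\<^sub>R b \<Longrightarrow> s < 0"
  shows "hurwitz M"
  using assms left_char_root_iff unfolding hurwitz_def by meson

text \<open>Adding the Lyapunov forms at a and b cancels the terms with w by symmetry of D. What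
  remains is 2s times a positive number, and it is negative.\<close>

lemma hurwitz_certificate:
  assumes D: "pd D" and L: "pd (- lyap M D)"
  shows "hurwitz M"
proof (rule hurwitzI_left)
  fix a b s w assume ab: "a \<noteq> 0 \<or> b \<noteq> 0" and a: "a v* M = s *\<^sub>R a - w *\<^sub>R b" and b: "b v* M = w *\<^sub>R a + s *\<^sub>R b"
  have sy: "a \<bullet> (D *v b) = b \<bullet> (D *v a)" using symmetric_dot pd_sym[OF D] by blast
  have nn: "0 \<le> qf N x" if "pd N" for N x using that pd_imp_psd psd_qf by blast
  have "qf (- lyap M D) a + qf (- lyap M D) b > 0"
    using ab pd_qf[OF L, of a] pd_qf[OF L, of b] nn[OF L, of a] nn[OF L, of b] by linarith
  moreover have "qf (- lyap M D) a + qf (- lyap M D) b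
      = - (2 * (s * qf D a - w * (b \<bullet> (D *v a)))) - 2 * (w * (a \<bullet> (D *v b)) + s * qf D b)"
    by (simp only: qf_minus qf_lyap[OF pd_sym[OF D]] a b inner_diff_left inner_add_left inner_scaleR_left)
  moreover have "\<dots> = - 2 * (s * (qf D a + qf D b))"
    unfolding sy by (simp add: distrib_left)
  ultimately have "s * (qf D a + qf D b) < 0" by linarith
  moreover have "qf D a + qf D b > 0"
    using ab pd_qf[OF D, of a] pd_qf[OF D, of b] nn[OF D, of a] nn[OF D, of b] by linarith
  ultimately show "s < 0" by (simp add: mult_less_0_iff)
qed

text \<open>Minimising the quotient of the two forms on the sphere gives a semidefinite combination
  with nontrivial kernel, on which the Lyapunov form would have to vanish.\<close>
lemma lyap_pd:
  assumes D0: "pd D0" "pd (- lyap M D0)" and D: "transpose D = D" "pd (- lyap M D)"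
  shows "pd D"
proof -
  define f where "f x = qf D x / qf D0 x" for x
  have pos: "qf D0 x > 0" if "x \<noteq> 0" for x using that D0 pd_qf by blast
  have "compact (sphere 0 1 :: (real^'a) set)" by simp
  moreover have "(sphere 0 1 :: (real^'a) set) \<noteq> {}" by simp
  moreover have "continuous_on (sphere 0 1) f" unfolding f_def
  proof (intro continuous_intros ballI)
    fix x :: "real^'a" assume "x \<in> sphere 0 1"
    then show "qf D0 x \<noteq> 0" using pos[of x] by force
  qed
  ultimately have "\<exists>v\<in>sphere 0 1. \<forall>y\<in>sphere 0 1. f v \<le> f y"
    by (rule continuous_attains_inf)
  then obtain v where v: "v \<in> sphere 0 1" "\<And>y. y \<in> sphere 0 1 \<Longrightarrow> f v \<le> f y"
    by blast
  have v0: "v \<noteq> 0" using v(1) by force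
  have min: "f v * qf D0 x \<le> qf D x" for x
  proof (cases "x = 0")
    case False
    have "f v \<le> f ((1 / norm x) *\<^sub>R x)" by (rule v(2)) (use False in auto)
    also have "\<dots> = f x" unfolding f_def qf_scaleR_vec using False by simp
    finally show ?thesis using pos[OF False] by (simp add: f_def field_simps)
  qed simp
  have eq: "f v * qf D0 v = qf D v" unfolding f_def using pos[OF v0] by simp
  have "f v > 0"
  proof (rule ccontr)
    assume "\<not> f v > 0"
    then have fv: "f v \<le> 0" by simp
    let ?E = "D - f v *\<^sub>R D0"
    have sE: "transpose ?E = ?E" using D(1) pd_sym[OF D0(1)] by (simp add: mat_distribs)
    have "psd ?E" unfolding psd_def using sE min by (simp add: qf_diff qf_scaleR)
    then have "?E *v v = 0" by (rule psd_kernel) (simp add: qf_diff qf_scaleR eq)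
    then have "qf (lyap M ?E) v = 0" by (simp add: qf_lyap[OF sE])
    then have "qf (- lyap M D) v = f v * qf (- lyap M D0) v"
      by (simp add: lyap_diff lyap_scaleR qf_diff qf_scaleR qf_minus)
    moreover have "qf (- lyap M D) v > 0" using D(2) v0 pd_qf by blast
    moreover have "f v * qf (- lyap M D0) v \<le> 0"
      using fv pd_qf[OF D0(2) v0] by (simp add: mult_nonpos_nonneg)
    ultimately show False by simp
  qed
  then show ?thesis unfolding pd_def using D(1) min pos
    by (metis less_le_trans mult_pos_pos)
qed

text \<open>Reduction to the strict case: D + d D0 has a strictly negative Lyapunov form for every d
  > 0, and d can be taken arbitrarily small.\<close>

lemma lyap_psd:
  assumes D0: "pd D0" "pd (- lyap M D0)" and D: "transpose D = D" "psd (- lyap M D)"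
  shows "psd D"
  unfolding psd_def
proof (intro conjI allI D(1))
  fix x
  have "0 < qf D x + e" if e: "e > 0" for e
  proof (cases "x = 0")
    case False
    define d where "d = e / (2 * qf D0 x)"
    have q: "qf D0 x > 0" using D0(1) False pd_qf by blast
    then have d: "d > 0" using e by (simp add: d_def)
    have "pd (D + d *\<^sub>R D0)"
    proof (rule lyap_pd[OF D0])
      show "transpose (D + d *\<^sub>R D0) = D + d *\<^sub>R D0" using D(1) pd_sym[OF D0(1)] by (simp add: mat_distribs)
      then have t: "transpose (lyap M (D + d *\<^sub>R D0)) = lyap M (D + d *\<^sub>R D0)" by (simp add: transpose_lyap)
      show "pd (- lyap M (D + d *\<^sub>R D0))"
        unfolding pd_def
      proof (intro conjI allI impI)
        fix y :: "real^'a" assume y: "y \<noteq> 0"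
        have "qf (- lyap M (D + d *\<^sub>R D0)) y = qf (- lyap M D) y + d * qf (- lyap M D0) y"
          by (simp add: lyap_add lyap_scaleR qf_add qf_diff qf_scaleR qf_minus)
        moreover have "qf (- lyap M D) y \<ge> 0" using D(2) psd_qf by blast
        moreover have "d * qf (- lyap M D0) y > 0" using d pd_qf[OF D0(2) y] by simp
        ultimately show "0 < qf (- lyap M (D + d *\<^sub>R D0)) y" by linarith
      qed (use t in \<open>simp add: transpose_minus\<close>)
    qed
    then have "0 < qf D x + d * qf D0 x" using False pd_qf[of _ x] by (fastforce simp: qf_add qf_scaleR)
    moreover have "d * qf D0 x = e / 2" using q by (simp add: d_def)
    ultimately show ?thesis using e by linarith
  qed (use e in simp)
  then show "0 \<le> qf D x" by (metis add_le_cancel_right field_le_epsilon less_eq_real_def add.commute)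
qed

section \<open>The Lyapunov equation\<close>

lemma cmat_mul: "cmat (A ** B) = cmat A ** cmat B"
  by (simp add: cmat_def matrix_matrix_mult_def vec_eq_iff)

lemma cmat_minus: "cmat (- A) = - cmat A"
  by (simp add: cmat_def vec_eq_iff)

lemma cmat_0: "cmat 0 = 0"
  by (simp add: cmat_def vec_eq_iff)

lemma cmat_eq_0_iff: "cmat A = 0 \<longleftrightarrow> A = 0"
  by (simp add: cmat_def vec_eq_iff)

lemma mat_mul_entry: "(mat z ** N) $ i $ j = z * N $ i $ j" for N :: "'a::comm_ring_1^'m^'n"
  by (simp add: mat_def matrix_matrix_mult_def if_distrib if_distribR cong: if_cong)

lemma mul_mat_entry: "(N ** mat z) $ i $ j = z * N $ i $ j" for N :: "'a::comm_ring_1^'m^'n"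
  by (simp add: mat_def matrix_matrix_mult_def if_distrib if_distribR mult.commute cong: if_cong)

lemma mat_mul_commute: "N ** mat z = mat z ** N" for N :: "'a::comm_ring_1^'n^'n"
  by (simp add: vec_eq_iff mat_mul_entry mul_mat_entry)

lemma mat_plus: "mat (a + b) = mat a + mat b" for a :: "'a::ring_1"
  by (simp add: mat_def vec_eq_iff)

lemma mat_uminus: "mat (- a) = - mat a" for a :: "'a::ring_1"
  by (simp add: mat_def vec_eq_iff)

lemma mat_times: "mat (a * b) = mat a ** mat b" for a :: "'a::comm_ring_1"
  by (simp add: vec_eq_iff mat_mul_entry) (simp add: mat_def)

lemma matrix_mul_0_right [simp]: "M ** 0 = 0"
  by (simp add: vec_eq_iff matrix_matrix_mult_def)

lemma matrix_mul_0_left [simp]: "0 ** M = 0"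
  by (simp add: vec_eq_iff matrix_matrix_mult_def)

lemma cancel_left_det:
  fixes N E :: "'a::field^'n^'n"
  assumes "det N \<noteq> 0" "N ** E = 0"
  shows "E = 0"
proof -
  obtain B where B: "B ** N = mat 1" using assms(1) by (metis invertible_det_nz invertible_left_inverse)
  have "E = B ** (N ** E)" by (simp add: matrix_mul_assoc B)
  then show ?thesis unfolding assms(2) by (simp add: matrix_matrix_mult_def vec_eq_iff)
qed

lemma cancel_right_det:
  fixes N E :: "'a::field^'n^'n"
  assumes "det N \<noteq> 0" "E ** N = 0"
  shows "E = 0"
proof -
  obtain B where B: "N ** B = mat 1" using assms(1) by (metis invertible_det_nz invertible_right_inverse)
  have "E = (E ** N) ** B" by (simp add: matrix_mul_assoc [symmetric] B)
  then show ?thesis unfolding assms(2) by (simp add: matrix_matrix_mult_def vec_eq_iff)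
qed

text \<open>This is p(M) D by Horner's scheme, where \<open>mat c ** D\<close> is the complex
  multiple c D. Only the action on the fixed matrix D matters, so p(M) itself is never
  formed.\<close>

definition mpoly :: "complex^'n^'n \<Rightarrow> complex^'n^'n \<Rightarrow> complex poly \<Rightarrow> complex^'n^'n" where
  "mpoly M D p = fold_coeffs (\<lambda>c N. mat c ** D + M ** N) p 0"

lemma mpoly_0 [simp]: "mpoly M D 0 = 0"
  by (simp add: mpoly_def)

lemma mpoly_pCons [simp]: "mpoly M D (pCons c p) = mat c ** D + M ** mpoly M D p"
proof (cases "c = 0 \<and> p = 0")
  case True
  then show ?thesis by (simp add: vec_eq_iff matrix_matrix_mult_def)
qed (auto simp: mpoly_def)

lemma mpoly_add: "mpoly M D (p + q) = mpoly M D p + mpoly M D q"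
proof (induction p q rule: poly_induct2)
  case (pCons a p b q)
  then show ?case by (simp add: matrix_add_ldistrib mat_plus matrix_mul_add_left)
qed simp

lemma mpoly_smult: "mpoly M D (smult z p) = mat z ** mpoly M D p"
proof (induction p)
  case (pCons c p)
  have "M ** (mat z ** mpoly M D p) = mat z ** (M ** mpoly M D p)"
    by (simp add: matrix_mul_assoc mat_mul_commute)
  then show ?case using pCons
    by (simp add: matrix_add_ldistrib mat_times matrix_mul_assoc)
qed simp

lemma mpoly_monom: "mpoly M D (monom z i) = mat z ** (((**) M ^^ i) D)"
proof (induction i)
  case (Suc i)
  have "mat 0 ** D = 0" by (simp add: vec_eq_iff mat_mul_entry)
  then show ?case using Suc by (simp add: monom_Suc matrix_mul_assoc mat_mul_commute)
qed (simp add: monom_0 vec_eq_iff matrix_matrix_mult_def)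

lemma mpoly_sum: "mpoly M D (\<Sum>i\<in>I. f i) = (\<Sum>i\<in>I. mpoly M D (f i))"
  by (induction I rule: infinite_finite_induct) (simp_all add: mpoly_add)

lemma mpoly_root:
  "mpoly M D ([:- z, 1:] * q) = - ((mat z - M) ** mpoly M D q)"
proof -
  have "[:- z, 1:] * q = smult (- z) q + pCons 0 q" by simp
  then have "mpoly M D ([:- z, 1:] * q) = mat (- z) ** mpoly M D q + M ** mpoly M D q"
    by (simp only: mpoly_add mpoly_smult mpoly_pCons mat_0 matrix_mul_0_left add_0)
  also have "\<dots> = - ((mat z - M) ** mpoly M D q)"
    by (simp add: mat_uminus mat_distribs)
  finally show ?thesis .
qed

text \<open>Each p(M) D is again an intertwiner of M and N, so a factor on its left can be traded
  for one on its right.\<close>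

lemma mpoly_intertwine:
  assumes "M ** D = D ** N"
  shows "M ** mpoly M D p = mpoly M D p ** N"
proof (induction p)
  case (pCons c p)
  have a: "M ** (mat c ** D) = mat c ** D ** N"
    by (simp add: matrix_mul_assoc mat_mul_commute) (simp add: matrix_mul_assoc [symmetric] assms)
  have b: "M ** (M ** mpoly M D p) = M ** mpoly M D p ** N"
    unfolding pCons(2) by (simp only: matrix_mul_assoc pCons(2))
  show ?case by (simp only: mpoly_pCons matrix_add_ldistrib matrix_mul_add_left a b)
qed simp

text \<open>\<open>dependent\<close> speaks of sets and cannot see a repeated member of the family.
  A repetition is treated apart, with coefficients 1 and -1.\<close>

lemma linear_dependence_seq:
  fixes N :: "nat \<Rightarrow> 'a::euclidean_space"
  obtains c :: "nat \<Rightarrow> real" and n where "(\<Sum>i\<le>n. c i *\<^sub>R N i) = 0" "\<exists>i\<le>n. c i \<noteq> 0"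
proof (cases "inj_on N {..DIM('a)}")
  case True
  let ?S = "N ` {..DIM('a)}"
  have "card ?S > DIM('a)" using True by (simp add: card_image)
  then have "dependent ?S" by (intro dependent_biggerset) auto
  then obtain u where u: "\<exists>v\<in>?S. u v \<noteq> 0" "(\<Sum>v\<in>?S. u v *\<^sub>R v) = 0"
    by (subst (asm) dependent_finite) auto
  show ?thesis
  proof (rule that[where n = "DIM('a)" and c = "u \<circ> N"])
    show "(\<Sum>i\<le>DIM('a). (u \<circ> N) i *\<^sub>R N i) = 0"
      using u(2) by (subst (asm) sum.reindex[OF True]) (simp add: o_def)
    show "\<exists>i\<le>DIM('a). (u \<circ> N) i \<noteq> 0" using u(1) by auto
  qed
next
  case False
  then obtain i j where ij: "i \<le> DIM('a)" "j \<le> DIM('a)" "i \<noteq> j" "N i = N j"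
    by (auto simp: inj_on_def)
  define c where "c k = (if k = i then 1 else if k = j then -1 else 0 :: real)" for k
  have "(\<Sum>k\<le>DIM('a). c k *\<^sub>R N k) = (\<Sum>k\<le>DIM('a). (if k = i then N k else 0) - (if k = j then N k else 0))"
    using ij(3) by (intro sum.cong) (auto simp: c_def)
  also have "\<dots> = 0" using ij by (simp add: sum_subtractf)
  finally show ?thesis using ij(1) by (intro that[of c "DIM('a)"]) (auto simp: c_def)
qed

lemma hurwitz_det_nz: "hurwitz M \<Longrightarrow> Re z \<ge> 0 \<Longrightarrow> det (mat z - cmat M) \<noteq> 0"
  unfolding hurwitz_def by force

text \<open>Some nonzero polynomial in M kills D. A root z of it can be divided out: since MD = - D M^T,
  the factor M - z may be moved to the right of D as - M^T - z, and one of the two is invertible.\<close>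
lemma lyap_injective:
  assumes M: "hurwitz M" and D: "lyap M D = 0"
  shows "D = 0"
proof -
  let ?M = "cmat M" and ?D = "cmat D" and ?T = "cmat (- transpose M)"
  have "M ** D = D ** (- transpose M)"
    using D by (simp add: lyap_def matrix_mul_minus_right eq_neg_iff_add_eq_0)
  then have MD: "?M ** ?D = ?D ** ?T" by (metis cmat_mul)
  have *: "mpoly ?M ?D p = 0 \<Longrightarrow> p \<noteq> 0 \<Longrightarrow> ?D = 0" for p
  proof (induction "degree p" arbitrary: p rule: less_induct)
    case less
    show ?case
    proof (cases "degree p = 0")
      case True
      then obtain c where p: "p = [:c:]" by (metis degree_eq_zeroE)
      then have "mat c ** ?D = 0" using less by simp
      then have "c * ?D $ i $ j = 0" for i j
        by (metis mat_mul_entry zero_index)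
      moreover have "c \<noteq> 0" using less p by simp
      ultimately show ?thesis by (simp add: vec_eq_iff)
    next
      case False
      then obtain z where "poly p z = 0" using alg_closed_imp_poly_has_root[of p] by auto
      then obtain q where q: "p = [:- z, 1:] * q" by (metis poly_eq_0_iff_dvd dvdE)
      have q0: "q \<noteq> 0" using less q by auto
      have deg: "degree q < degree p" unfolding q using q0 by (subst degree_mult_eq) auto
      have r: "(mat z - ?M) ** mpoly ?M ?D q = 0" using less(2) unfolding q mpoly_root by simp
      have "mpoly ?M ?D q = 0"
      proof (cases "Re z \<ge> 0")
        case True
        then show ?thesis using cancel_left_det[OF hurwitz_det_nz[OF M] r] by simp
      next
        case False
        have "mpoly ?M ?D q ** (mat (- z) - cmat (transpose M)) =
            - ((mat z - ?M) ** mpoly ?M ?D q)"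
          using mpoly_intertwine[OF MD, of q]
          by (simp add: mat_distribs mat_uminus mat_mul_commute cmat_minus)
        then have r: "mpoly ?M ?D q ** (mat (- z) - cmat (transpose M)) = 0" using r by simp
        \<comment> \<open>Here -z lies in the open right half plane, and the transpose has the same
          characteristic roots as M.\<close>
        have "det (mat (- z) - cmat (transpose M)) \<noteq> 0"
          unfolding char_root_transpose using hurwitz_det_nz[OF M, of "-z"] False by simp
        then show ?thesis using cancel_right_det r by blast
      qed
      then show ?thesis using less(1)[OF deg] q0 by blast
    qed
  qed
  \<comment> \<open>The matrices M^i D lie in a finite-dimensional real space, so the annihilating
    polynomial can be taken with real coefficients.\<close>
  obtain c n where c: "(\<Sum>i\<le>n. c i *\<^sub>R (((**) M ^^ i) D)) = 0" "\<exists>i\<le>n. c i \<noteq> 0"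
    using linear_dependence_seq[of "\<lambda>i. ((**) M ^^ i) D"] by blast
  define p where "p = (\<Sum>i\<le>n. monom (complex_of_real (c i)) i)"
  have pw: "((**) ?M ^^ i) ?D = cmat (((**) M ^^ i) D)" for i
    by (induction i) (simp_all add: cmat_mul)
  have "mpoly ?M ?D p = cmat (\<Sum>i\<le>n. c i *\<^sub>R (((**) M ^^ i) D))"
    unfolding p_def mpoly_sum mpoly_monom pw
    by (simp add: vec_eq_iff mat_mul_entry) (simp add: cmat_def)
  then have "mpoly ?M ?D p = 0" by (simp add: c(1) cmat_0)
  moreover have "p \<noteq> 0"
  proof
    assume "p = 0"
    moreover have "coeff p i = complex_of_real (c i)" if "i \<le> n" for i
      using that by (simp add: p_def coeff_sum)
    ultimately show False using c(2) by auto
  qed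
  ultimately show ?thesis using * cmat_eq_0_iff by blast
qed

text \<open>An injective linear map of a finite-dimensional space is onto. The transpose of a
  solution is a solution too, so injectivity makes the solution symmetric.\<close>

lemma lyap_solve:
  assumes M: "hurwitz M" and P: "transpose P = P"
  obtains D where "transpose D = D" "lyap M D = P"
proof -
  have "inj (lyap M)"
    using lyap_injective[OF M] lyap_linear linear_injective_0 by blast
  then have "surj (lyap M)" using linear_injective_imp_surjective lyap_linear by blast
  then obtain D where D: "lyap M D = P" by (metis surjD)
  have "lyap M (transpose D) = P" using transpose_lyap[of M D] D P by simp
  then have "transpose D = D" using \<open>inj (lyap M)\<close> D by (metis injD)
  then show ?thesis using that D by blast
qed

lemma pd_perturb:
  assumes P: "pd P" and N: "transpose N = N"
  obtains e where "e > 0" "\<And>t. \<bar>t\<bar> \<le> e \<Longrightarrow> pd (P + t *\<^sub>R N)"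
proof -
  obtain c where c: "c > 0" "\<And>x. c * (x \<bullet> x) \<le> qf P x" using pd_lower[OF P] by blast
  \<comment> \<open>With this e the perturbation uses up at most half of the lower bound c; the + 1
    covers N = 0.\<close>
  define e where "e = c / (2 * (norm N + 1))"
  have n: "norm N + 1 > 0" using norm_ge_zero[of N] by linarith
  then have e: "e > 0" using c by (simp add: e_def)
  have "pd (P + t *\<^sub>R N)" if t: "\<bar>t\<bar> \<le> e" for t
    unfolding pd_def
  proof (intro conjI allI impI)
    show "transpose (P + t *\<^sub>R N) = P + t *\<^sub>R N" using N pd_sym[OF P] by (simp add: mat_distribs)
    fix x :: "real^'a" assume x: "x \<noteq> 0"
    have "\<bar>t * qf N x\<bar> \<le> e * ((norm N + 1) * (x \<bullet> x))"
      unfolding abs_mult using qf_norm_bound[of x N] t e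
      by (intro mult_mono) (auto intro: order_trans[OF _ mult_right_mono])
    also have "e * ((norm N + 1) * (x \<bullet> x)) = e * (norm N + 1) * (x \<bullet> x)" by (simp only: mult.assoc)
    also have "e * (norm N + 1) = c / 2" using n by (simp add: e_def field_simps)
    also have "c / 2 * (x \<bullet> x) < c * (x \<bullet> x)" using c x by simp
    finally show "0 < qf (P + t *\<^sub>R N) x" using c(2)[of x] by (simp add: qf_add qf_scaleR)
  qed
  with e show ?thesis using that by blast
qed

lemma pd_scaleR: "pd M \<Longrightarrow> k > 0 \<Longrightarrow> pd (k *\<^sub>R M)"
  by (simp add: pd_def transpose_scalar qf_scaleR)

lemma pd_mat_1: "pd (mat 1 :: real^'n^'n)"
  by (simp add: pd_def)

lemma lyap_shift: "lyap (M - r *\<^sub>R mat 1) D = lyap M D - (2 * r) *\<^sub>R D"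
proof -
  show ?thesis by (simp add: lyap_def mat_distribs algebra_simps flip: scaleR_2)
qed

lemma hurwitz_shift:
  assumes M: "hurwitz M" and r: "r \<ge> 0"
  shows "hurwitz (M - r *\<^sub>R mat 1)"
proof (rule hurwitzI_left)
  fix a b s w
  assume ab: "a \<noteq> 0 \<or> b \<noteq> 0"
    and a: "a v* (M - r *\<^sub>R mat 1) = s *\<^sub>R a - w *\<^sub>R b" and b: "b v* (M - r *\<^sub>R mat 1) = w *\<^sub>R a + s *\<^sub>R b"
  have *: "x v* (M - r *\<^sub>R mat 1) = x v* M - r *\<^sub>R x" for x
    by (simp add: vector_matrix_mult_diff_rdistrib vector_scaleR_matrix_ac)
  have "s + r < 0"
    using a b unfolding * by (intro hurwitzD_left[OF M ab, where w = w]) (simp_all add: algebra_simps)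
  then show "s < 0" using r by simp
qed

text \<open>M - r I has a certificate for large r; solving the Lyapunov equation at the infimum of such r
  gives a certificate that is valid in a neighbourhood, so the infimum is 0.\<close>
lemma hurwitz_imp_certificate:
  assumes M: "hurwitz M"
  obtains D where "pd D" "pd (- lyap M D)"
proof -
  let ?M = "\<lambda>r. M - r *\<^sub>R mat 1"
  define C where "C = {r. r \<ge> 0 \<and> (\<exists>D. pd D \<and> pd (- lyap (?M r) D))}"
  define r0 where "r0 = Inf C"
  have bdd: "bdd_below C" unfolding C_def by (rule bdd_belowI[of _ 0]) auto
  \<comment> \<open>The identity is a certificate once r exceeds the norm of
    \<open>lyap M (mat 1)\<close>, because the shift subtracts \<open>2 * r\<close> times the
    identity.\<close>
  have ne: "C \<noteq> {}"
  proof -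
    let ?L = "lyap M (mat 1)"
    have "pd (- lyap (?M (norm ?L + 1)) (mat 1))"
      unfolding pd_def
    proof (intro conjI allI impI)
      show "transpose (- lyap (?M (norm ?L + 1)) (mat 1)) = - lyap (?M (norm ?L + 1)) (mat 1)"
        by (simp add: transpose_minus transpose_lyap)
      fix x :: "real^'a" assume x: "x \<noteq> 0"
      then have "x \<bullet> x > 0" by simp
      then have "(norm ?L + 2) * (x \<bullet> x) > 0" by (intro mult_pos_pos) (auto simp: add_nonneg_pos)
      moreover have "\<bar>qf ?L x\<bar> \<le> norm ?L * (x \<bullet> x)" by (rule qf_norm_bound)
      ultimately show "0 < qf (- lyap (?M (norm ?L + 1)) (mat 1)) x"
        unfolding lyap_shift by (simp add: qf_minus qf_diff qf_scaleR algebra_simps)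
    qed
    then have "norm ?L + 1 \<in> C" unfolding C_def using pd_mat_1 by (auto intro: add_nonneg_nonneg)
    then show ?thesis by blast
  qed
  have r0: "r0 \<ge> 0" unfolding r0_def by (rule cInf_greatest[OF ne]) (simp add: C_def)
  obtain D where D: "transpose D = D" "lyap (?M r0) D = - mat 1"
    using lyap_solve[OF hurwitz_shift[OF M r0], of "- mat 1"] by (auto simp: transpose_minus)
  obtain e where e: "e > 0" "\<And>t. \<bar>t\<bar> \<le> e \<Longrightarrow> pd (mat 1 + t *\<^sub>R D)"
    using pd_perturb[OF pd_mat_1 D(1)] by blast
  have L: "- lyap (?M r) D = mat 1 + (2 * (r - r0)) *\<^sub>R D" for r
  proof -
    have "- lyap (?M r) D = - lyap (?M r0) D + (2 * (r - r0)) *\<^sub>R D"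
      by (simp add: lyap_shift algebra_simps)
    then show ?thesis by (simp add: D(2))
  qed
  \<comment> \<open>The shift enters the Lyapunov form with a factor 2, hence the half-width
    \<open>e / 2\<close> below.\<close>
  have near: "pd (- lyap (?M r) D)" if "\<bar>2 * (r - r0)\<bar> \<le> e" for r
    unfolding L using e(2) that by blast
  obtain r where r: "r \<in> C" "r < r0 + e / 2"
    using cInf_lessD[OF ne, of "r0 + e / 2"] e unfolding r0_def by auto
  have "r0 \<le> r" unfolding r0_def using cInf_lower[OF r(1) bdd] .
  obtain D1 where "pd D1" "pd (- lyap (?M r) D1)" using r(1) C_def by auto
  \<comment> \<open>D is compared with a certificate at some r of C close to r0, since the infimum
    r0 is not known to belong to C.\<close>
  then have pD: "pd D" using lyap_pd D(1) near[of r] \<open>r0 \<le> r\<close> r(2) by fastforce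
  have "r0 = 0"
  proof (rule ccontr)
    assume "r0 \<noteq> 0"
    define r' where "r' = max 0 (r0 - e / 2)"
    have "r' \<in> C" unfolding C_def using near[of r'] pD e(1) r0 by (auto simp: r'_def max_def)
    then have "r0 \<le> r'" unfolding r0_def using bdd by (rule cInf_lower)
    then show False using \<open>r0 \<noteq> 0\<close> r0 e(1) by (simp add: r'_def max_def split: if_splits)
  qed
  then show ?thesis using that[OF pD] near[of 0] e(1) by simp
qed

lemma hurwitz_lyap_pd: "hurwitz M \<Longrightarrow> transpose D = D \<Longrightarrow> pd (- lyap M D) \<Longrightarrow> pd D"
  by (metis hurwitz_imp_certificate lyap_pd)

lemma hurwitz_lyap_psd: "hurwitz M \<Longrightarrow> transpose D = D \<Longrightarrow> psd (- lyap M D) \<Longrightarrow> psd D"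
  by (metis hurwitz_imp_certificate lyap_psd)

section \<open>The Riccati inequality\<close>

lemma bounded_bilinear_matrix_mul:
  "bounded_bilinear ((**) :: real^'n^'m \<Rightarrow> real^'p^'n \<Rightarrow> real^'p^'m)"
  unfolding bilinear_conv_bounded_bilinear [symmetric] bilinear_def
  by (auto intro!: linearI simp: mat_distribs matrix_add_ldistrib)

lemma bounded_bilinear_matrix_vector:
  "bounded_bilinear ((*v) :: real^'n^'m \<Rightarrow> real^'n \<Rightarrow> real^'m)"
  unfolding bilinear_conv_bounded_bilinear [symmetric] bilinear_def
  by (auto intro!: linearI simp: mv_distribs)

lemma bounded_linear_transpose: "bounded_linear (transpose :: real^'n^'m \<Rightarrow> real^'m^'n)"
  unfolding linear_conv_bounded_linear [symmetric]
  by (auto intro!: linearI simp: mat_distribs)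

lemmas matrix_continuous_intros =
  bounded_bilinear.continuous_on[OF bounded_bilinear_matrix_mul]
  bounded_bilinear.continuous_on[OF bounded_bilinear_matrix_vector]
  bounded_linear.continuous_on[OF bounded_linear_transpose]

lemmas matrix_tendsto_intros =
  bounded_bilinear.tendsto[OF bounded_bilinear_matrix_mul]
  bounded_bilinear.tendsto[OF bounded_bilinear_matrix_vector]
  bounded_linear.tendsto[OF bounded_linear_transpose]

lemma continuous_trace: "continuous_on S f \<Longrightarrow> continuous_on S (\<lambda>x. trace (f x :: real^'n^'n))"
  unfolding trace_def by (intro continuous_intros)

section \<open>Bounds and limits of semidefinite matrices\<close>

lemma closed_psd: "closed {M. psd M}"
  unfolding psd_def
  by (intro closed_Collect_conj closed_Collect_eq closed_Collect_all closed_Collect_le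
      continuous_intros matrix_continuous_intros)

lemma tendsto_psd: "(\<And>n. psd (f n)) \<Longrightarrow> f \<longlonglongrightarrow> M \<Longrightarrow> psd M"
  using closed_sequentially[OF closed_psd, of f M] by simp

lemma psd_add: "psd M \<Longrightarrow> psd N \<Longrightarrow> psd (M + N)"
  and pd_add_psd: "pd M \<Longrightarrow> psd N \<Longrightarrow> pd (M + N)"
  and psd_scaleR: "k \<ge> 0 \<Longrightarrow> psd M \<Longrightarrow> psd (k *\<^sub>R M)"
  by (auto simp: psd_def pd_def transpose_add transpose_scalar qf_add qf_scaleR add_pos_nonneg)

lemma psd_zero: "psd 0"
  by (simp add: psd_def)

lemma psd_sandwich: "psd S \<Longrightarrow> transpose E = E \<Longrightarrow> psd (E ** S ** E)"
  by (simp add: psd_def qf_sandwich matrix_transpose_mul matrix_mul_assoc)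

lemma diag_qf: "M $ i $ i = qf M (axis i 1)" for M :: "real^'n^'n"
  by (simp add: matrix_vector_mult_basis column_def inner_axis_axis inner_axis inner_commute[of "axis i 1"])

lemma trace_qf: "trace M = (\<Sum>i\<in>UNIV. qf M (axis i 1))" for M :: "real^'n^'n"
  unfolding trace_def diag_qf ..

text \<open>Testing M with the sum and the difference of two basis vectors bounds every entry by the
  trace. Bounds on traces thus become compactness.\<close>

lemma psd_norm_le_trace: "psd M \<Longrightarrow> norm M \<le> real CARD('n) * (real CARD('n) * trace M)"
  for M :: "real^'n^'n"
proof -
  assume M: "psd M"
  have e: "axis i 1 \<bullet> (M *v axis j 1) = M $ i $ j" for i j
    by (simp add: matrix_vector_mult_basis column_def inner_axis inner_commute[of "axis i 1"])
  have dn: "0 \<le> M $ i $ i" for i unfolding diag_qf using M psd_qf by blast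
  have dt: "M $ i $ i \<le> trace M" for i
    unfolding trace_def by (rule member_le_sum) (use dn in auto)
  have "\<bar>M $ i $ j\<bar> \<le> trace M" for i j
  proof -
    have "0 \<le> qf M (axis j 1 + s *\<^sub>R axis i 1)" for s using M psd_qf by blast
    then have *: "0 \<le> M $ j $ j + 2 * s * (M $ i $ j) + s\<^sup>2 * M $ i $ i" for s
      unfolding psd_polar[OF psd_sym[OF M]] by (simp add: e)
    show ?thesis using *[of 1] *[of "-1"] dt[of i] dt[of j] by simp
  qed
  then have "norm (M $ i) \<le> real CARD('n) * trace M" for i
    by (intro order_trans[OF norm_le_l1_cart] sum_bounded_above) auto
  then have "(\<Sum>i\<in>UNIV. norm (M $ i)) \<le> real CARD('n) * (real CARD('n) * trace M)"
    by (intro sum_bounded_above) auto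
  moreover have "norm M \<le> (\<Sum>i\<in>UNIV. norm (M $ i))"
    unfolding norm_vec_def by (rule L2_set_le_sum) auto
  ultimately show ?thesis by simp
qed

lemma psd_Cauchy_Schwarz:
  assumes M: "psd M"
  shows "(y \<bullet> (M *v x))\<^sup>2 \<le> qf M x * qf M y"
proof (cases "qf M y = 0")
  case True
  then have "M *v y = 0" using M psd_kernel by blast
  then have "y \<bullet> (M *v x) = 0" using symmetric_dot[OF psd_sym[OF M], of y x] by simp
  then show ?thesis using True by simp
next
  case False
  then have q: "qf M y > 0" using psd_qf[OF M, of y] by linarith
  let ?c = "y \<bullet> (M *v x)"
  have "0 \<le> qf M (x + (- ?c / qf M y) *\<^sub>R y)" using M psd_qf by blast
  also have "\<dots> = qf M x - ?c\<^sup>2 / qf M y"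
    unfolding psd_polar[OF psd_sym[OF M]] using q by (simp add: power2_eq_square field_simps)
  finally show ?thesis using q by (simp add: field_simps)
qed

text \<open>Cauchy-Schwarz for the form of M, taken with y = Mx; then one factor |Mx|^2 is
  cancelled.\<close>

lemma psd_norm_vec_bound:
  assumes M: "psd M"
  shows "(M *v x) \<bullet> (M *v x) \<le> norm M * qf M x"
proof (cases "M *v x = 0")
  case False
  let ?y = "M *v x"
  have y: "?y \<bullet> ?y > 0" using False by simp
  have "(?y \<bullet> ?y) * (?y \<bullet> ?y) \<le> qf M x * qf M ?y"
    using psd_Cauchy_Schwarz[OF M, of ?y x] by (simp add: power2_eq_square)
  also have "\<dots> \<le> qf M x * (norm M * (?y \<bullet> ?y))"
    using qf_norm_bound[of ?y M] psd_qf[OF M, of x] by (intro mult_left_mono) auto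
  finally have "(?y \<bullet> ?y) * (?y \<bullet> ?y) \<le> (norm M * qf M x) * (?y \<bullet> ?y)" by (simp add: mult_ac)
  then show ?thesis using y by (simp only: mult_le_cancel_right_pos)
qed (use psd_qf[OF M] in simp)

text \<open>On a kernel vector of E the Lyapunov form would vanish.\<close>

lemma psd_lyap_pd:
  assumes "psd E" "pd (- lyap M E)"
  shows "pd E"
  unfolding pd_def
proof (intro conjI allI impI)
  show "transpose E = E" using assms(1) by (rule psd_sym)
  fix x :: "real^'a" assume x: "x \<noteq> 0"
  have "qf E x \<noteq> 0"
  proof
    assume "qf E x = 0"
    then have "E *v x = 0" using assms(1) psd_kernel by blast
    then have "qf (lyap M E) x = 0" by (simp add: qf_lyap[OF psd_sym[OF assms(1)]])
    then show False using pd_qf[OF assms(2) x] by (simp add: qf_minus)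
  qed
  then show "0 < qf E x" using psd_qf[OF assms(1), of x] by linarith
qed

text \<open>On a kernel vector of X every term of the Riccati form vanishes except that of
  W.\<close>

lemma riccati_subsolution_pd:
  assumes X: "psd X" and W: "pd W" and R: "psd (- riccati A S t W X)"
  shows "pd X"
  unfolding pd_def
proof (intro conjI allI impI)
  show "transpose X = X" using X by (rule psd_sym)
  fix x :: "real^'a" assume x: "x \<noteq> 0"
  have "qf X x \<noteq> 0"
  proof
    assume "qf X x = 0"
    then have "X *v x = 0" using X psd_kernel by blast
    then have "qf (riccati A S t W X) x = qf W x" by (simp add: qf_riccati[OF psd_sym[OF X]])
    then show False using psd_qf[OF R, of x] pd_qf[OF W x] by (simp add: qf_minus)
  qed
  then show "0 < qf X x" using psd_qf[OF X, of x] by linarith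
qed

section \<open>Existence and comparison of stabilizing solutions\<close>

lemma minus_eq_of_diff_eq: "a - b = c + d \<Longrightarrow> - c = - a + (b + d)" for a b c d :: "'a::ab_group_add"
  by (simp add: algebra_simps)

lemma tendsto_riccati:
  assumes "X \<longlonglongrightarrow> X0" "A \<longlonglongrightarrow> A0" "S \<longlonglongrightarrow> S0" "t \<longlonglongrightarrow> t0"
  shows "(\<lambda>n. riccati (A n) (S n) (t n) W (X n)) \<longlonglongrightarrow> riccati A0 S0 t0 W X0"
  unfolding riccati_def by (intro tendsto_intros matrix_tendsto_intros assms)

text \<open>On the compact set of X with 0 \<le> X \<le> Y and riccati X \<ge> 0, the Newton step stays
  in the set and increases X, so a point of maximal trace is a solution.\<close>
lemma riccati_strict_imp_stabilizing:
  assumes S: "psd S" and W: "psd W" and t: "t \<ge> 0"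
    and Y: "pd Y" "pd (- riccati A S t W Y)"
  obtains X where "psd X" "psd (Y - X)" "riccati A S t W X = 0" "hurwitz (A + t *\<^sub>R (X ** S))"
proof -
  define \<Sigma> where "\<Sigma> = {X. psd X \<and> psd (Y - X) \<and> psd (riccati A S t W X)}"
  have "closed \<Sigma>"
  proof -
    have "\<Sigma> = {M. psd M} \<inter> (\<lambda>X. Y - X) -` {M. psd M} \<inter> riccati A S t W -` {M. psd M}"
      by (auto simp: \<Sigma>_def)
    then show ?thesis unfolding riccati_def
      by (simp only:) (intro closed_Int closed_psd closed_vimage continuous_intros matrix_continuous_intros)
  qed
  moreover have "bounded \<Sigma>"
    unfolding bounded_iff
  proof (intro exI ballI)
    fix X assume X: "X \<in> \<Sigma>"
    then have "trace X \<le> trace Y" using psd_trace_nonneg[of "Y - X"] by (simp add: \<Sigma>_def trace_sub)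
    then have "real CARD('a) * (real CARD('a) * trace X) \<le> real CARD('a) * (real CARD('a) * trace Y)"
      by (intro mult_left_mono) auto
    moreover have "norm X \<le> real CARD('a) * (real CARD('a) * trace X)"
      using X by (intro psd_norm_le_trace) (simp add: \<Sigma>_def)
    ultimately show "norm X \<le> real CARD('a) * (real CARD('a) * trace Y)" by (rule order_trans[rotated])
  qed
  ultimately have "compact \<Sigma>" by (simp add: compact_eq_bounded_closed)
  moreover have "\<Sigma> \<noteq> {}"
  proof -
    have "0 \<in> \<Sigma>" using W pd_imp_psd[OF Y(1)] by (simp add: \<Sigma>_def psd_zero riccati_def)
    then show ?thesis by blast
  qed
  moreover have "continuous_on \<Sigma> trace" by (intro continuous_trace continuous_intros)
  ultimately have "\<exists>X\<in>\<Sigma>. \<forall>Z\<in>\<Sigma>. trace Z \<le> trace X" by (rule continuous_attains_sup)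
  then obtain X where X: "X \<in> \<Sigma>" and max: "\<And>Z. Z \<in> \<Sigma> \<Longrightarrow> trace Z \<le> trace X" by blast
  let ?R = "riccati A S t W" and ?M = "A + t *\<^sub>R (X ** S)" and ?E = "Y - X"
  have pX: "psd X" and pE: "psd ?E" and pR: "psd (?R X)" using X by (auto simp: \<Sigma>_def)
  note diff = riccati_diff[OF psd_sym[OF pX] psd_sym[OF S], of A t W]
  have ESE: "psd (t *\<^sub>R (?E ** S ** ?E))" using psd_scaleR[OF t psd_sandwich[OF S psd_sym[OF pE]]] .
  \<comment> \<open>Strictness of Y makes Y - X a Lyapunov certificate for the closed loop at X.
    Hence that closed loop is Hurwitz and the Newton equation can be solved.\<close>
  have LE: "- lyap ?M ?E = - ?R Y + (?R X + t *\<^sub>R (?E ** S ** ?E))"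
    using diff[of Y] by (rule minus_eq_of_diff_eq)
  have "pd (- lyap ?M ?E)" unfolding LE by (intro pd_add_psd psd_add Y pR ESE)
  moreover from this have "pd ?E" using pE psd_lyap_pd by blast
  ultimately have hM: "hurwitz ?M" by (intro hurwitz_certificate)
  have "transpose (- ?R X) = - ?R X" using psd_sym[OF pR] by (simp add: transpose_minus)
  \<comment> \<open>D is the Newton correction: it cancels the linear part, so the value at X + D is
    the psd remainder alone.\<close>
  then obtain D where D: "transpose D = D" "lyap ?M D = - ?R X" using lyap_solve[OF hM] by blast
  have pD: "psd D" using hurwitz_lyap_psd[OF hM D(1)] pR by (simp add: D(2))
  have "?R (X + D) = t *\<^sub>R (D ** S ** D)" using diff[of "X + D"] D(2) by simp
  then have "psd (?R (X + D))" using psd_scaleR[OF t psd_sandwich[OF S D(1)]] by simp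
  \<comment> \<open>The residual at X cancels between the Lyapunov equations of Y - X and of D,
    which leaves only psd terms.\<close>
  moreover have "psd (Y - (X + D))"
  proof (rule hurwitz_lyap_psd[OF hM])
    show "transpose (Y - (X + D)) = Y - (X + D)"
      using pd_sym[OF Y(1)] psd_sym[OF pX] D(1) by (simp add: mat_distribs)
    have "- lyap ?M (?E - D) = - ?R Y + t *\<^sub>R (?E ** S ** ?E)"
      unfolding lyap_diff[of ?M ?E D] D(2) using LE by simp
    moreover have "?E - D = Y - (X + D)" by simp
    ultimately show "psd (- lyap ?M (Y - (X + D)))"
      using psd_add[OF pd_imp_psd[OF Y(2)] ESE] by metis
  qed
  ultimately have "X + D \<in> \<Sigma>" using psd_add[OF pX pD] by (simp add: \<Sigma>_def)
  then have "trace D \<le> 0" using max[of "X + D"] by (simp add: trace_add)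
  then have "D = 0" using psd_trace_nonneg[OF pD] psd_trace_zero[OF pD] by linarith
  then have "?R X = 0" using D(2) by (simp add: lyap_def)
  then show ?thesis using that pX pE hM by blast
qed

text \<open>By \<open>riccati_diff\<close> the difference Y - X has a Lyapunov form of the right
  sign, and the closed loop at X is Hurwitz.\<close>

lemma stabilizing_le_subsolution:
  assumes S: "psd S" and t: "t \<ge> 0"
    and X: "transpose X = X" "riccati A S t W X = 0" "hurwitz (A + t *\<^sub>R (X ** S))"
    and Y: "transpose Y = Y" "psd (- riccati A S t W Y)"
  shows "psd (Y - X)"
proof (rule hurwitz_lyap_psd[OF X(3)])
  show sE: "transpose (Y - X) = Y - X" using X Y by (simp add: mat_distribs)
  have "- lyap (A + t *\<^sub>R (X ** S)) (Y - X) = - riccati A S t W Y + t *\<^sub>R ((Y - X) ** S ** (Y - X))"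
    using riccati_diff[OF X(1) psd_sym[OF S], of A t W Y] X(2) by (simp add: algebra_simps)
  then show "psd (- lyap (A + t *\<^sub>R (X ** S)) (Y - X))"
    using psd_add[OF Y(2) psd_scaleR[OF t psd_sandwich[OF S sE]]] by simp
qed

lemma psd_antisym: "psd (X - Y) \<Longrightarrow> psd (Y - X) \<Longrightarrow> X = Y"
proof -
  assume a: "psd (X - Y)" and b: "psd (Y - X)"
  have "X - Y = 0"
  proof (rule symmetric_eq_zero)
    show "transpose (X - Y) = X - Y" using a by (rule psd_sym)
    show "qf (X - Y) x = 0" for x using psd_qf[OF a, of x] psd_qf[OF b, of x] by (simp add: qf_diff)
  qed
  then show ?thesis by simp
qed

text \<open>A solution is also a subsolution, so each of the two lies below the other.\<close>

lemma stabilizing_unique: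
  assumes "psd S" "t \<ge> 0"
    and "transpose X = X" "riccati A S t W X = 0" "hurwitz (A + t *\<^sub>R (X ** S))"
    and "transpose Y = Y" "riccati A S t W Y = 0" "hurwitz (A + t *\<^sub>R (Y ** S))"
  shows "X = Y"
proof (rule psd_antisym)
  show "psd (X - Y)"
    by (rule stabilizing_le_subsolution[OF assms(1,2) assms(6,7,8) assms(3)]) (simp add: assms(4) psd_zero)
  show "psd (Y - X)"
    by (rule stabilizing_le_subsolution[OF assms(1,2) assms(3,4,5) assms(6)]) (simp add: assms(7) psd_zero)
qed

lemma riccati_perturb_t: "riccati A S (t + s) W X = riccati A S t W X + s *\<^sub>R (X ** S ** X)"
  by (simp add: riccati_def algebra_simps)

lemma riccati_perturb_W: "riccati A S t ((1 + s) *\<^sub>R W) X = riccati A S t W X + s *\<^sub>R W"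
  by (simp add: riccati_def algebra_simps)

text \<open>Step from X in the direction D that the closed-loop Lyapunov operator sends to -I. The
  Riccati map becomes -dI plus a remainder of order d^2.\<close>

lemma stabilizing_imp_strict:
  assumes S: "psd S" and t: "t \<ge> 0"
    and X: "psd X" "riccati A S t W X = 0" "hurwitz (A + t *\<^sub>R (X ** S))"
  obtains Y where "pd Y" "pd (- riccati A S t W Y)"
proof -
  let ?M = "A + t *\<^sub>R (X ** S)"
  obtain D where D: "transpose D = D" "lyap ?M D = - mat 1"
    using lyap_solve[OF X(3), of "- mat 1"] by (auto simp: transpose_minus)
  have pD: "pd D" using hurwitz_lyap_pd[OF X(3) D(1)] by (simp add: D(2) pd_mat_1)
  have "transpose (D ** S ** D) = D ** S ** D" using psd_sym[OF psd_sandwich[OF S D(1)]] .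
  then obtain e where e: "e > 0" "\<And>s. \<bar>s\<bar> \<le> e \<Longrightarrow> pd (mat 1 + s *\<^sub>R (D ** S ** D))"
    using pd_perturb[OF pd_mat_1] by blast
  \<comment> \<open>This makes \<open>d * t \<le> e\<close>, so the remainder stays below d times
    the identity; the + 1 covers t = 0.\<close>
  define d where "d = e / (t + 1)"
  have d: "d > 0" "d * t \<le> e" using e t by (auto simp: d_def field_simps)
  have "- riccati A S t W (X + d *\<^sub>R D) = d *\<^sub>R (mat 1 + (- (d * t)) *\<^sub>R (D ** S ** D))"
    using riccati_diff[OF psd_sym[OF X(1)] psd_sym[OF S], of A t W "X + d *\<^sub>R D"] X(2) D(2)
    by (simp add: lyap_scaleR mat_distribs algebra_simps)
  then have "pd (- riccati A S t W (X + d *\<^sub>R D))"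
    using pd_scaleR[OF e(2) d(1), of "- (d * t)"] d t by simp
  moreover have "pd (X + d *\<^sub>R D)"
    using pd_add_psd[OF pd_scaleR[OF pD d(1)] X(1)] by (simp add: add.commute)
  ultimately show ?thesis using that by blast
qed

text \<open>At a unit vector v the quadratic term is at least t s |Xv|^2, while the linear term is
  at most 2 |A| |Xv|. Dividing by |Xv| bounds it by data that stay controlled along sequences of t
  or of K.\<close>

lemma riccati_subsolution_trace_bound:
  fixes A :: "real^'n^'n"
  assumes X: "psd X" and R: "psd (- riccati A S t W X)" and W: "psd W" and t: "t > 0"
    and s: "s > 0" "\<And>x. s * (x \<bullet> x) \<le> qf S x"
  shows "trace X \<le> real CARD('n) * (2 * norm (transpose A) / (t * s))"
proof -
  have "qf X v \<le> 2 * norm (transpose A) / (t * s)" if v: "norm v = 1" for v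
  proof -
    let ?y = "norm (X *v v)"
    have "t * s * ?y\<^sup>2 \<le> t * qf S (X *v v)"
      using s(2)[of "X *v v"] t by (simp add: dot_square_norm)
    also have "\<dots> \<le> - 2 * ((v v* A) \<bullet> (X *v v))"
      using psd_qf[OF R, of v] psd_qf[OF W, of v] by (simp add: qf_minus qf_riccati[OF psd_sym[OF X]])
    also have "\<dots> \<le> 2 * (norm (v v* A) * ?y)"
      using Cauchy_Schwarz_ineq2[of "v v* A" "X *v v"] by linarith
    also have "\<dots> \<le> 2 * (norm (transpose A) * ?y)"
      using matrix_vector_norm_bound[of "transpose A" v] v by (intro mult_left_mono mult_right_mono) auto
    finally have le: "(t * s * ?y) * ?y \<le> (2 * norm (transpose A)) * ?y"
      by (simp add: power2_eq_square mult_ac)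
    have "t * s * ?y \<le> 2 * norm (transpose A)"
    proof (cases "?y = 0")
      case False
      then have "?y > 0" by simp
      then show ?thesis using le by (simp only: mult_le_cancel_right_pos)
    qed simp
    then have "?y \<le> 2 * norm (transpose A) / (t * s)" using t s(1) by (simp add: field_simps)
    moreover have "qf X v \<le> ?y" using Cauchy_Schwarz_ineq2[of v "X *v v"] v by simp
    ultimately show ?thesis by linarith
  qed
  then show ?thesis unfolding trace_qf by (intro sum_bounded_above) auto
qed

section \<open>Stabilizing solutions below the gain bound\<close>

text \<open>Dissipation argument with storage matrix X^-1: the inequality is tested at X^-1 v1 and
  X^-1 v2. The frequency terms cancel, and Young's inequality with weight d trades the cross term
  for the W term and the input energy divided by d.\<close>

lemma pd_subsolution_gain:
  fixes A X :: "real^'n^'n" and B :: "real^'k^'n"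
  assumes X: "pd X" and d: "d > 0" and R: "psd (- riccati A S t (d *\<^sub>R (B ** transpose B)) X)"
    and v: "A *v v1 + B *v u1 = - (w *\<^sub>R v2)" "A *v v2 + B *v u2 = w *\<^sub>R v1"
  shows "t * (qf S v1 + qf S v2) \<le> (u1 \<bullet> u1 + u2 \<bullet> u2) / d"
proof -
  obtain Y where Y: "X ** Y = mat 1" using pd_imp_invertible[OF X] invertible_right_inverse by blast
  define a b where "a = Y *v v1" and "b = Y *v v2"
  have a: "X *v a = v1" and b: "X *v b = v2" by (simp_all add: a_def b_def matrix_vector_mul_assoc Y)
  define p q where "p = a v* B" and "q = b v* B"
  have sym: "a \<bullet> v2 = b \<bullet> v1" using symmetric_dot[OF pd_sym[OF X], of a b] a b by simp
  have Av: "A *v v1 = - (w *\<^sub>R v2) - B *v u1" "A *v v2 = w *\<^sub>R v1 - B *v u2"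
    using v by (simp_all add: eq_diff_eq)
  have young: "2 * (p \<bullet> u) \<le> d * (p \<bullet> p) + (u \<bullet> u) / d" for p u :: "real^'k"
  proof -
    have "0 \<le> (d *\<^sub>R p - u) \<bullet> (d *\<^sub>R p - u)" by simp
    also have "\<dots> = d * (d * (p \<bullet> p) + (u \<bullet> u) / d - 2 * (p \<bullet> u))"
      using d by (simp add: inner_diff_left inner_diff_right inner_commute[of u p] algebra_simps)
    finally show ?thesis using d by (simp add: zero_le_mult_iff)
  qed
  have "qf (riccati A S t (d *\<^sub>R (B ** transpose B)) X) a =
      2 * (- w * (a \<bullet> v2) - p \<bullet> u1) + t * qf S v1 + d * (p \<bullet> p)"
    by (simp add: qf_riccati[OF pd_sym[OF X]] a dot_lmul_matrix Av qf_scaleR qf_gram p_def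
        inner_diff_right del: transpose_matrix_vector)
  moreover have "qf (riccati A S t (d *\<^sub>R (B ** transpose B)) X) b =
      2 * (w * (b \<bullet> v1) - q \<bullet> u2) + t * qf S v2 + d * (q \<bullet> q)"
    by (simp add: qf_riccati[OF pd_sym[OF X]] b dot_lmul_matrix Av qf_scaleR qf_gram q_def
        inner_diff_right del: transpose_matrix_vector)
  ultimately have "t * (qf S v1 + qf S v2) + d * (p \<bullet> p + q \<bullet> q) \<le> 2 * (p \<bullet> u1 + q \<bullet> u2)"
    using psd_qf[OF R, of a] psd_qf[OF R, of b] sym by (simp add: qf_minus algebra_simps)
  then show ?thesis
    using young[of p u1] young[of q u2] unfolding add_divide_distrib distrib_left by linarith
qed

text \<open>Complex data in real form: w is the frequency, u = u1 + i u2 the input and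
  v = v1 + i v2 the state with (i w - A) v = B u.\<close>
definition gain_lt :: "real^'n^'n \<Rightarrow> real^'k^'n \<Rightarrow> real^'n^'n \<Rightarrow> real \<Rightarrow> bool" where
  "gain_lt A B S t \<longleftrightarrow> (\<forall>w u1 u2 v1 v2. (u1 \<noteq> 0 \<or> u2 \<noteq> 0) \<longrightarrow>
     A *v v1 + B *v u1 = - (w *\<^sub>R v2) \<longrightarrow> A *v v2 + B *v u2 = w *\<^sub>R v1 \<longrightarrow>
     t * (qf S v1 + qf S v2) < u1 \<bullet> u1 + u2 \<bullet> u2)"

lemma gain_ltD:
  assumes "gain_lt A B S t" "u1 \<noteq> 0 \<or> u2 \<noteq> 0"
    "A *v v1 + B *v u1 = - (w *\<^sub>R v2)" "A *v v2 + B *v u2 = w *\<^sub>R v1"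
  shows "t * (qf S v1 + qf S v2) < u1 \<bullet> u1 + u2 \<bullet> u2"
  using assms unfolding gain_lt_def by blast

text \<open>This is the eigenvector relation of the Hamiltonian matrix, in real form. For a left
  eigenvector of the closed loop with eigenvalue z, its image under X is the open-loop state at -z
  for the input obtained by applying the transpose of B.\<close>

lemma left_char_vec_riccati:
  fixes A X :: "real^'n^'n" and B :: "real^'k^'n"
  assumes X: "transpose X = X" and S: "transpose S = S"
    and R: "riccati A S t (B ** transpose B) X = 0"
    and a: "a v* (A + t *\<^sub>R (X ** S)) = s *\<^sub>R a - w *\<^sub>R b"
  shows "A *v (X *v a) + B *v (a v* B) = - (s *\<^sub>R (X *v a)) + w *\<^sub>R (X *v b)"
    "a v* A = s *\<^sub>R a - w *\<^sub>R b - t *\<^sub>R (S *v (X *v a))"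
proof -
  have "a v* (X ** S) = S *v (X *v a)"
    by (metis S X symmetric_vector_matrix vector_matrix_mul_assoc)
  then show aA: "a v* A = s *\<^sub>R a - w *\<^sub>R b - t *\<^sub>R (S *v (X *v a))"
    using a by (simp add: vector_matrix_mult_add_rdistrib vector_scaleR_matrix_ac algebra_simps)
  have "0 = riccati A S t (B ** transpose B) X *v a" by (simp add: R)
  also have "\<dots> = A *v (X *v a) + X *v (a v* A) + t *\<^sub>R (X *v (S *v (X *v a))) + B *v (a v* B)"
    by (simp add: riccati_def mv_distribs matrix_vector_mul_assoc [symmetric])
  also have "\<dots> = A *v (X *v a) + s *\<^sub>R (X *v a) - w *\<^sub>R (X *v b) + B *v (a v* B)"
    unfolding aA by (simp add: mv_distribs)
  finally show "A *v (X *v a) + B *v (a v* B) = - (s *\<^sub>R (X *v a)) + w *\<^sub>R (X *v b)"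
    by (simp add: algebra_simps)
qed

text \<open>On the imaginary axis Xa and Xb are the state for the inputs \<open>a v* B\<close> and
  \<open>b v* B\<close> at frequency -w. The Riccati equation tested at a and b equates t times the
  weighted state energy with the input energy, against the strict gain bound. The inputs do not both
  vanish because \<open>B ** transpose B\<close> is definite.\<close>

lemma no_imaginary_char_root:
  fixes A X :: "real^'n^'n" and B :: "real^'k^'n"
  assumes X: "transpose X = X" and S: "psd S" and W: "pd (B ** transpose B)"
    and R: "riccati A S t (B ** transpose B) X = 0"
    and gain: "gain_lt A B S t1" and t: "t \<le> t1"
    and ab: "a \<noteq> 0 \<or> b \<noteq> 0"
    and a: "a v* (A + t *\<^sub>R (X ** S)) = - (w *\<^sub>R b)" and b: "b v* (A + t *\<^sub>R (X ** S)) = w *\<^sub>R a"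
  shows False
proof -
  let ?v1 = "X *v a" and ?v2 = "X *v b" and ?u1 = "a v* B" and ?u2 = "b v* B"
  note S' = psd_sym[OF S]
  have ra: "A *v ?v1 + B *v ?u1 = w *\<^sub>R ?v2" "a v* A = - (w *\<^sub>R b) - t *\<^sub>R (S *v ?v1)"
    using left_char_vec_riccati[OF X S' R, of a 0 w b] a by simp_all
  have rb: "A *v ?v2 + B *v ?u2 = - (w *\<^sub>R ?v1)" "b v* A = w *\<^sub>R a - t *\<^sub>R (S *v ?v2)"
    using left_char_vec_riccati[OF X S' R, of b 0 "-w" a] b by simp_all
  have u: "?u1 \<noteq> 0 \<or> ?u2 \<noteq> 0"
  proof -
    have "qf (B ** transpose B) x \<noteq> 0" if "x \<noteq> 0" for x using pd_qf[OF W that] by simp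
    then show ?thesis using ab unfolding qf_gram by fastforce
  qed
  have lt: "t1 * (qf S ?v1 + qf S ?v2) < ?u1 \<bullet> ?u1 + ?u2 \<bullet> ?u2"
    using gain_ltD[OF gain u, of ?v1 "- w" ?v2] ra(1) rb(1) by simp
  have "0 = qf (riccati A S t (B ** transpose B) X) a + qf (riccati A S t (B ** transpose B) X) b"
    by (simp add: R)
  also have "\<dots> = 2 * ((a v* A) \<bullet> ?v1) + t * qf S ?v1 + ?u1 \<bullet> ?u1 + (2 * ((b v* A) \<bullet> ?v2) + t * qf S ?v2 + ?u2 \<bullet> ?u2)"
    unfolding qf_riccati[OF X] qf_gram by simp
  also have "(a v* A) \<bullet> ?v1 = - w * (b \<bullet> ?v1) - t * qf S ?v1"
    unfolding ra(2) inner_diff_left by (simp add: inner_commute[of "S *v ?v1"])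
  also have "(b v* A) \<bullet> ?v2 = w * (a \<bullet> ?v2) - t * qf S ?v2"
    unfolding rb(2) inner_diff_left by (simp add: inner_commute[of "S *v ?v2"])
  also have "b \<bullet> ?v1 = a \<bullet> ?v2" by (rule symmetric_dot[OF X])
  finally have "t * (qf S ?v1 + qf S ?v2) = ?u1 \<bullet> ?u1 + ?u2 \<bullet> ?u2" by (simp add: algebra_simps)
  moreover have "t * (qf S ?v1 + qf S ?v2) \<le> t1 * (qf S ?v1 + qf S ?v2)"
    using t psd_qf[OF S] by (intro mult_right_mono add_nonneg_nonneg) auto
  ultimately show False using lt by simp
qed

text \<open>For a root with s > 0 let E be the gap X0 - X n. Summed over a and b, the Lyapunov form
  of E is 2s times the form of E. It also equals t0 times that of ESE minus a strictly positive
  term, and ESE is at most \<open>norm S * norm E\<close> times E. For n large the two are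
  incompatible.\<close>

lemma riccati_limit_hurwitz:
  fixes A :: "real^'n^'n" and B :: "real^'k^'n"
  assumes S: "pd S" and W: "pd (B ** transpose B)"
    and gain: "gain_lt A B S t1" and t0: "t0 \<le> t1"
    and X: "\<And>n. psd (X n)" "\<And>n. riccati A S (t n) (B ** transpose B) (X n) = 0"
      "\<And>n. hurwitz (A + t n *\<^sub>R (X n ** S))" "\<And>n. 0 \<le> t n" "\<And>n. t n < t0"
    and X0: "X \<longlonglongrightarrow> X0" "riccati A S t0 (B ** transpose B) X0 = 0" "psd X0"
  shows "hurwitz (A + t0 *\<^sub>R (X0 ** S))"
proof (rule hurwitzI_left)
  let ?W = "B ** transpose B" and ?M = "A + t0 *\<^sub>R (X0 ** S)"
  fix a b s w
  assume ab: "a \<noteq> 0 \<or> b \<noteq> 0" and a: "a v* ?M = s *\<^sub>R a - w *\<^sub>R b" and b: "b v* ?M = w *\<^sub>R a + s *\<^sub>R b"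
  note sX0 = psd_sym[OF X0(3)] and pS = pd_imp_psd[OF S] and sS = pd_sym[OF S]
  have "s \<noteq> 0"
    using no_imaginary_char_root[OF sX0 pS W X0(2) gain t0 ab, of w] a b by auto
  moreover have "\<not> s > 0"
  proof
    assume s: "s > 0"
    have "(\<lambda>n. norm (X0 - X n)) \<longlonglongrightarrow> norm (X0 - X0)" by (intro tendsto_intros X0)
    then have "(\<lambda>n. t0 * (norm S * norm (X0 - X n))) \<longlonglongrightarrow> t0 * (norm S * norm (X0 - X0))"
      by (intro tendsto_mult_left)
    then have "eventually (\<lambda>n. t0 * (norm S * norm (X0 - X n)) < 2 * s) sequentially"
      by (rule order_tendstoD) (use s in simp)
    then obtain n where n: "t0 * (norm S * norm (X0 - X n)) < 2 * s"
      by (auto simp: eventually_sequentially)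
    let ?E = "X0 - X n"
    have t00: "t0 > 0" using X(4,5)[of n] by simp
    have pX: "pd (X n)" using riccati_subsolution_pd[OF X(1) W] X(2) psd_zero by (metis neg_0_equal_iff_equal)
    have XSX: "psd (X0 ** S ** X0)" using psd_sandwich[OF pS sX0] .
    \<comment> \<open>At the smaller parameter t n the limit X0 is a subsolution, so X n lies below
      it.\<close>
    have "riccati A S (t n) ?W X0 = - ((t0 - t n) *\<^sub>R (X0 ** S ** X0))"
      using riccati_perturb_t[of A S t0 "t n - t0" ?W X0] X0(2) by (simp add: algebra_simps)
    then have pE: "psd ?E"
      using X(5)[of n] psd_scaleR[OF _ XSX, of "t0 - t n"]
      by (intro stabilizing_le_subsolution[OF pS X(4) psd_sym[OF X(1)] X(2) X(3) sX0]) simp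
    have sE: "transpose ?E = ?E" using psd_sym[OF pE] .
    have r1: "riccati A S t0 ?W (X n) = (t0 - t n) *\<^sub>R (X n ** S ** X n)"
      using riccati_perturb_t[of A S "t n" "t0 - t n" ?W "X n"] X(2) by simp
    have r2: "lyap ?M (X n - X0) = - lyap ?M ?E"
      using lyap_scaleR[of ?M "-1" ?E] by simp
    have r3: "(X n - X0) ** S ** (X n - X0) = ?E ** S ** ?E"
      using arg_cong[of _ _ "\<lambda>E. E ** S ** E", OF minus_diff_eq[of X0 "X n"]]
      by (simp add: matrix_mul_minus_left matrix_mul_minus_right del: minus_diff_eq)
    have aux: "l = e - x" if "x - 0 = - l + e" for x l e :: "real^'n^'n"
      using that by (simp add: algebra_simps)
    have L: "lyap ?M ?E = t0 *\<^sub>R (?E ** S ** ?E) - (t0 - t n) *\<^sub>R (X n ** S ** X n)"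
      by (rule aux) (use riccati_diff[OF sX0 sS, of A t0 ?W "X n"] in \<open>simp only: r1 r2 r3 X0(2)\<close>)
    have "qf (lyap ?M ?E) a = 2 * (s * qf ?E a - w * (b \<bullet> (?E *v a)))"
      "qf (lyap ?M ?E) b = 2 * (w * (a \<bullet> (?E *v b)) + s * qf ?E b)"
      unfolding qf_lyap[OF sE] a b by (simp_all add: inner_diff_left inner_add_left)
    moreover have "la + lb = 2 * s * (qa + qb)"
      if "la = 2 * (s * qa - w * x)" "lb = 2 * (w * y + s * qb)" "y = x" for la lb qa qb x y
      using that by (simp add: algebra_simps)
    ultimately have "qf (lyap ?M ?E) a + qf (lyap ?M ?E) b = 2 * s * (qf ?E a + qf ?E b)"
      using symmetric_dot[OF sE, of a b] by blast
    moreover have q: "qf (lyap ?M ?E) x = t0 * qf S (?E *v x) - (t0 - t n) * qf S (X n *v x)" for x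
      unfolding L qf_diff qf_scaleR qf_sandwich[OF sE] qf_sandwich[OF psd_sym[OF X(1)]] ..
    moreover have "t0 * qf S (?E *v x) \<le> t0 * (norm S * norm ?E) * qf ?E x" for x
    proof -
      have "qf S (?E *v x) \<le> norm S * ((?E *v x) \<bullet> (?E *v x))" using qf_norm_bound[of "?E *v x" S] by simp
      also have "\<dots> \<le> norm S * (norm ?E * qf ?E x)" using psd_norm_vec_bound[OF pE] by (intro mult_left_mono) auto
      finally show ?thesis using t00 by simp
    qed
    moreover have "(t0 - t n) * (qf S (X n *v a) + qf S (X n *v b)) > 0"
    proof (intro mult_pos_pos)
      have nz: "X n *v x \<noteq> 0" if "x \<noteq> 0" for x using pd_qf[OF pX that] by force
      show "qf S (X n *v a) + qf S (X n *v b) > 0"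
        using ab nz[of a] nz[of b] pd_qf[OF S] psd_qf[OF pS, of "X n *v a"] psd_qf[OF pS, of "X n *v b"]
        by (metis add_pos_nonneg add_nonneg_pos)
    qed (use X(5)[of n] in simp)
    ultimately have "2 * s * (qf ?E a + qf ?E b) < t0 * (norm S * norm ?E) * qf ?E a + t0 * (norm S * norm ?E) * qf ?E b"
      by (smt (verit) distrib_left)
    moreover have "t0 * (norm S * norm ?E) * qf ?E x \<le> 2 * s * qf ?E x" for x
      using n psd_qf[OF pE, of x] by (intro mult_right_mono) auto
    ultimately show False by (smt (verit) distrib_left)
  qed
  ultimately show "s < 0" by linarith
qed

lemma stabilizing_solution_exists:
  fixes A :: "real^'n^'n" and B :: "real^'k^'n"
  assumes A: "hurwitz A" and S: "pd S" and W: "pd (B ** transpose B)"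
    and gain: "gain_lt A B S t1" and t1: "t1 \<ge> 0"
  obtains X where "psd X" "riccati A S t1 (B ** transpose B) X = 0" "hurwitz (A + t1 *\<^sub>R (X ** S))"
proof -
  let ?W = "B ** transpose B"
  define P where "P t X \<longleftrightarrow> psd X \<and> riccati A S t ?W X = 0 \<and> hurwitz (A + t *\<^sub>R (X ** S))" for t X
  note pS = pd_imp_psd[OF S] and pW = pd_imp_psd[OF W]
  \<comment> \<open>Start of the continuation: at t = 0 this is the Lyapunov equation of the Hurwitz
    matrix A.\<close>
  have P0: "\<exists>X. P 0 X"
  proof -
    obtain X where X: "transpose X = X" "lyap A X = - ?W"
      using lyap_solve[OF A, of "- ?W"] pd_sym[OF W] by (metis transpose_minus)
    then have "psd X" using hurwitz_lyap_psd[OF A X(1)] pW by simp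
    then show ?thesis using X(2) A unfolding P_def riccati_def lyap_def by auto
  qed
  have opn: "\<exists>e>0. \<forall>s. \<bar>s\<bar> \<le> e \<longrightarrow> t + s \<ge> 0 \<longrightarrow> (\<exists>X. P (t + s) X)" if t: "t \<ge> 0" and PX: "P t X" for t X
  proof -
    obtain Y where Y: "pd Y" "pd (- riccati A S t ?W Y)"
      using stabilizing_imp_strict[OF pS t] PX unfolding P_def by blast
    have "transpose (- (Y ** S ** Y)) = - (Y ** S ** Y)"
      using psd_sym[OF psd_sandwich[OF pS pd_sym[OF Y(1)]]] by (simp add: transpose_minus)
    then obtain e where e: "e > 0" "\<And>s. \<bar>s\<bar> \<le> e \<Longrightarrow> pd (- riccati A S t ?W Y + s *\<^sub>R (- (Y ** S ** Y)))"
      using pd_perturb[OF Y(2)] by blast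
    have "\<exists>X. P (t + s) X" if s: "\<bar>s\<bar> \<le> e" "t + s \<ge> 0" for s
    proof -
      \<comment> \<open>Openness: one strict subsolution at t serves all nearby parameters.\<close>
      have "pd (- riccati A S (t + s) ?W Y)"
        using e(2)[OF s(1)] by (simp add: riccati_perturb_t)
      then show ?thesis
        using riccati_strict_imp_stabilizing[OF pS pW s(2) Y(1)] unfolding P_def by metis
    qed
    then show ?thesis using e(1) by blast
  qed
  define T where "T = {t. 0 \<le> t \<and> t \<le> t1 \<and> (\<exists>X. P t X)}"
  define t0 where "t0 = Sup T"
  have T0: "0 \<in> T" using P0 t1 by (simp add: T_def)
  have bdd: "bdd_above T" by (rule bdd_aboveI[of _ t1]) (simp add: T_def)
  have t0: "0 \<le> t0" "t0 \<le> t1"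
    unfolding t0_def using T0 bdd by (auto intro: cSup_upper cSup_least simp: T_def)
  have "t0 \<in> T"
  proof (rule ccontr)
    assume nT: "t0 \<notin> T"
    then have t0p: "t0 > 0" using T0 t0 by (metis less_eq_real_def)
    \<comment> \<open>The offset 2 keeps t n above t0 / 2. The trace bound has t in its denominator
      and is thereby uniform in n.\<close>
    have "\<exists>t X. t0 * (1 - 1 / real (n + 2)) < t \<and> t < t0 \<and> P t X" for n
    proof -
      have "t0 * (1 - 1 / real (n + 2)) < t0" using t0p by (simp add: field_simps)
      then obtain t where t: "t \<in> T" "t0 * (1 - 1 / real (n + 2)) < t"
        using less_cSup_iff[OF _ bdd] T0 unfolding t0_def by blast
      moreover have "t \<le> t0" unfolding t0_def using t(1) bdd by (rule cSup_upper)
      moreover have "t \<noteq> t0" using t(1) nT by blast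
      ultimately show ?thesis unfolding T_def by force
    qed
    then obtain t X where tX: "\<And>n. t0 * (1 - 1 / real (n + 2)) < t n" "\<And>n. t n < t0" "\<And>n. P (t n) (X n)"
      by metis
    have half: "t0 / 2 \<le> t n" for n
    proof -
      have "t0 / 2 \<le> t0 * (1 - 1 / real (n + 2))" using t0p by (simp add: field_simps)
      then show ?thesis using tX(1)[of n] by (meson less_imp_le order_trans)
    qed
    have tlim: "t \<longlonglongrightarrow> t0"
    proof (rule tendsto_sandwich)
      have "(\<lambda>n. 1 / real (n + 2)) \<longlonglongrightarrow> 0"
        using LIMSEQ_ignore_initial_segment[OF lim_1_over_n, of 2] by simp
      then have "(\<lambda>n. t0 * (1 - 1 / real (n + 2))) \<longlonglongrightarrow> t0 * (1 - 0)" by (intro tendsto_intros)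
      then show "(\<lambda>n. t0 * (1 - 1 / real (n + 2))) \<longlonglongrightarrow> t0" by simp
      show "\<forall>\<^sub>F n in sequentially. t0 * (1 - 1 / real (n + 2)) \<le> t n"
        using tX(1) by (intro always_eventually allI less_imp_le)
      show "\<forall>\<^sub>F n in sequentially. t n \<le> t0"
        using tX(2) by (intro always_eventually allI less_imp_le)
    qed simp
    have X: "psd (X n)" "riccati A S (t n) ?W (X n) = 0" "hurwitz (A + t n *\<^sub>R (X n ** S))" for n
      using tX(3) by (auto simp: P_def)
    obtain c where c: "c > 0" "\<And>x. c * (x \<bullet> x) \<le> qf S x" using pd_lower[OF S] by blast
    define C where "C = real CARD('n) * (real CARD('n) * (real CARD('n) * (2 * norm (transpose A) / (t0 / 2 * c))))"
    have "norm (X n) \<le> C" for n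
    proof -
      have tn: "t n > 0" using half[of n] t0p by simp
      have "trace (X n) \<le> real CARD('n) * (2 * norm (transpose A) / (t n * c))"
        using X psd_zero by (intro riccati_subsolution_trace_bound[OF X(1) _ pW tn c]) simp_all
      also have "\<dots> \<le> real CARD('n) * (2 * norm (transpose A) / (t0 / 2 * c))"
        using half[of n] t0p c(1) tn by (intro mult_left_mono divide_left_mono mult_right_mono mult_pos_pos) auto
      finally have "real CARD('n) * (real CARD('n) * trace (X n)) \<le> C"
        unfolding C_def by (intro mult_left_mono) auto
      then show ?thesis using psd_norm_le_trace[OF X(1)[of n]] by linarith
    qed
    then have "bounded (range X)" by (auto simp: bounded_iff)
    then obtain X0 r where r: "strict_mono (r :: nat \<Rightarrow> nat)" "(X \<circ> r) \<longlonglongrightarrow> X0"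
      using bounded_imp_convergent_subsequence by blast
    have pX0: "psd X0" by (rule tendsto_psd[OF _ r(2)]) (simp add: X)
    have "(t \<circ> r) \<longlonglongrightarrow> t0" using tlim r(1) by (rule LIMSEQ_subseq_LIMSEQ)
    then have "(\<lambda>n. riccati A S ((t \<circ> r) n) ?W ((X \<circ> r) n)) \<longlonglongrightarrow> riccati A S t0 ?W X0"
      by (intro tendsto_riccati r(2) tendsto_const)
    then have RX0: "riccati A S t0 ?W X0 = 0" using X(2) by (simp add: LIMSEQ_const_iff)
    have "hurwitz (A + t0 *\<^sub>R (X0 ** S))"
      using X half t0p tX(2) less_imp_le
      by (intro riccati_limit_hurwitz[OF S W gain t0(2) _ _ _ _ _ r(2) RX0 pX0, where t = "t \<circ> r"])
        (auto intro: order_trans[of 0 "t0 / 2"])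
    then have "t0 \<in> T" using pX0 RX0 t0 unfolding T_def P_def by blast
    then show False using nT by blast
  qed
  then obtain X where X: "P t0 X" by (auto simp: T_def)
  have "t0 = t1"
  proof (rule ccontr)
    assume "t0 \<noteq> t1"
    obtain e where e: "e > 0" "\<And>s. \<bar>s\<bar> \<le> e \<Longrightarrow> t0 + s \<ge> 0 \<Longrightarrow> \<exists>X. P (t0 + s) X"
      using opn[OF t0(1) X] by blast
    define s where "s = min e (t1 - t0)"
    have s: "s > 0" "\<bar>s\<bar> \<le> e" "t0 + s \<le> t1" using e(1) t0 \<open>t0 \<noteq> t1\<close> by (auto simp: s_def)
    then have "t0 + s \<in> T" using e(2)[of s] t0 by (simp add: T_def)
    then have "t0 + s \<le> t0" unfolding t0_def using bdd by (rule cSup_upper)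
    then show False using s by simp
  qed
  then show ?thesis using X that unfolding P_def by blast
qed

section \<open>The H-infinity norm\<close>

text \<open>With S = cI - X, the equation S^2 = Q is the Riccati equation -2cX + X^2 + (c^2 I - Q) =
  0. Its closed loop is -S, so the stabilizing solution gives the positive definite root.\<close>

lemma pd_sqrt_exists:
  assumes Q: "pd Q"
  obtains S where "pd S" "S ** S = Q"
proof -
  \<comment> \<open>Then norm Q <= c <= c^2, which makes the constant term c^2 I - Q psd.\<close>
  define c where "c = norm Q + 1"
  have c: "c \<ge> 1" by (simp add: c_def)
  define W where "W = c\<^sup>2 *\<^sub>R mat 1 - Q"
  have W: "psd W"
    unfolding psd_def
  proof (intro conjI allI)
    show "transpose W = W" using pd_sym[OF Q] by (simp add: W_def mat_distribs)
    fix x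
    have "qf Q x \<le> norm Q * (x \<bullet> x)" using qf_norm_bound[of x Q] by simp
    also have "\<dots> \<le> c\<^sup>2 * (x \<bullet> x)"
    proof (rule mult_right_mono)
      have "norm Q \<le> c" by (simp add: c_def)
      also have "\<dots> \<le> c\<^sup>2" using c by (simp add: power2_eq_square)
      finally show "norm Q \<le> c\<^sup>2" .
    qed simp
    finally show "0 \<le> qf W x" by (simp add: W_def qf_diff qf_scaleR)
  qed
  obtain e where e: "e > 0" "\<And>s. \<bar>s\<bar> \<le> e \<Longrightarrow> pd (Q + s *\<^sub>R mat 1)"
    using pd_perturb[OF Q, of "mat 1"] by auto
  define d where "d = min (1 / 2) e"
  have d: "0 < d" "d < c" "d\<^sup>2 \<le> e"
  proof -
    show "0 < d" "d < c" using e c by (auto simp: d_def)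
    have "d\<^sup>2 \<le> 1 * d" unfolding power2_eq_square using e by (intro mult_right_mono) (auto simp: d_def)
    then show "d\<^sup>2 \<le> e" by (simp add: d_def)
  qed
  \<comment> \<open>The Riccati map here is (X - cI)^2 - Q, so (c - d)I is a strict subsolution as
    soon as d^2 I < Q.\<close>
  let ?A = "(- c) *\<^sub>R mat 1" and ?Y = "(c - d) *\<^sub>R mat 1"
  have "pd ?Y" using d by (intro pd_scaleR pd_mat_1) simp
  moreover have "- riccati ?A (mat 1) 1 W ?Y = Q + (- d\<^sup>2) *\<^sub>R mat 1"
    by (simp add: riccati_def W_def mat_distribs power2_eq_square algebra_simps)
  ultimately obtain X where X: "psd X" "riccati ?A (mat 1) 1 W X = 0" "hurwitz (?A + 1 *\<^sub>R (X ** mat 1))"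
    using riccati_strict_imp_stabilizing[OF pd_imp_psd[OF pd_mat_1] W, of 1 ?Y ?A] e(2)[of "- d\<^sup>2"] d by force
  define S where "S = c *\<^sub>R mat 1 - X"
  have SS: "S ** S = Q"
    using X(2) by (simp add: S_def riccati_def W_def mat_distribs power2_eq_square algebra_simps)
  have sS: "transpose S = S" using psd_sym[OF X(1)] by (simp add: S_def mat_distribs)
  have "hurwitz (- S)" using X(3) by (simp add: S_def)
  moreover have "- lyap (- S) S = 2 *\<^sub>R Q"
    using sS SS by (simp add: lyap_def mat_distribs scaleR_2)
  ultimately have "pd S" using hurwitz_lyap_pd[OF _ sS] pd_scaleR[OF Q, of 2] by simp
  then show ?thesis using that SS by blast
qed

text \<open>From ND + DN = 0 the psd matrix DND has trace 0 and vanishes. So N, hence S and T, hence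
  D, kill the range of D; as D is symmetric, D = 0.\<close>

lemma psd_sqrt_unique:
  assumes S: "psd S" and T: "psd T" and eq: "S ** S = T ** T"
  shows "S = T"
proof -
  define D where "D = S - T"
  define N where "N = S + T"
  have sD: "transpose D = D" using psd_sym[OF S] psd_sym[OF T] by (simp add: D_def mat_distribs)
  have N: "psd N" using S T unfolding N_def by (rule psd_add)
  have "N ** D + D ** N = 0" using eq by (simp add: N_def D_def mat_distribs)
  then have "trace (D ** (N ** D + D ** N)) = 0" by (simp add: trace_def)
  moreover have "trace (D ** (D ** N)) = trace (D ** N ** D)" by (rule trace_mul_sym)
  ultimately have "trace (D ** N ** D) = 0"
    by (simp add: matrix_add_ldistrib trace_add matrix_mul_assoc)
  then have DND: "D ** N ** D = 0" using psd_trace_zero[OF psd_sandwich[OF N sD]] by blast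
  have "D *v x = 0" for x
  proof -
    have "qf N (D *v x) = 0" using qf_sandwich[OF sD, of x N] DND by simp
    then have "qf S (D *v x) = 0" "qf T (D *v x) = 0"
      using psd_qf[OF S, of "D *v x"] psd_qf[OF T, of "D *v x"] by (simp_all add: N_def qf_add)
    then have "S *v (D *v x) = 0" "T *v (D *v x) = 0" using S T psd_kernel by blast+
    then have "D *v (D *v x) = 0" by (simp add: D_def mv_distribs)
    then have "(D *v x) \<bullet> (D *v x) = 0"
      using symmetric_dot[OF sD, of "D *v x" x] by simp
    then show ?thesis by simp
  qed
  then have "D = 0" by (simp add: matrix_eq)
  then show ?thesis by (simp add: D_def)
qed

lemma msqrt_props:
  assumes "pd Q"
  shows "psd (msqrt Q)" "msqrt Q ** msqrt Q = Q"
proof -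
  obtain S where S: "pd S" "S ** S = Q" using pd_sqrt_exists[OF assms] .
  have "psd (msqrt Q) \<and> msqrt Q ** msqrt Q = Q"
    unfolding msqrt_def
    by (rule theI[of _ S]) (use S pd_imp_psd psd_sqrt_unique in auto)
  then show "psd (msqrt Q)" "msqrt Q ** msqrt Q = Q" by auto
qed

lemma msqrt_norm: "pd Q \<Longrightarrow> (msqrt Q *v x) \<bullet> (msqrt Q *v x) = qf Q x"
  by (metis matrix_vector_mul_assoc msqrt_props psd_sym symmetric_dot)

text \<open>If E = TT with T symmetric, the trace is that of TPT. Roots are at hand for definite
  matrices, so E is first replaced by E + eI.\<close>

lemma psd_trace_mul_nonneg:
  assumes P: "psd P" and E: "psd E"
  shows "trace (P ** E) \<ge> 0"
proof -
  have "0 \<le> trace (P ** E) + e * trace P" if e: "e > 0" for e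
  proof -
    have "pd (E + e *\<^sub>R mat 1)" using pd_add_psd[OF pd_scaleR[OF pd_mat_1 e] E] by (simp add: add.commute)
    then obtain T where T: "pd T" "T ** T = E + e *\<^sub>R mat 1" using pd_sqrt_exists by blast
    have "trace (P ** E) + e * trace P = trace (P ** (T ** T))"
      by (simp add: T(2) matrix_add_ldistrib trace_add scaleR_matrix_mul_right)
        (simp add: trace_def sum_distrib_left)
    also have "\<dots> = trace (T ** P ** T)"
      by (metis matrix_mul_assoc trace_mul_sym)
    also have "\<dots> \<ge> 0" using psd_sandwich[OF P pd_sym[OF T(1)]] by (rule psd_trace_nonneg)
    finally show ?thesis .
  qed
  moreover have "trace P \<ge> 0" using P by (rule psd_trace_nonneg)
  ultimately have "- trace (P ** E) \<le> 0 + e" if "e > 0" for e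
  proof -
    have "e / (trace P + 1) > 0" using that \<open>trace P \<ge> 0\<close> by simp
    from \<open>\<And>e. e > 0 \<Longrightarrow> 0 \<le> trace (P ** E) + e * trace P\<close>[OF this]
    have "- trace (P ** E) \<le> e * (trace P / (trace P + 1))" by simp
    also have "\<dots> \<le> e * 1" using that \<open>trace P \<ge> 0\<close> by (intro mult_left_mono) auto
    finally show ?thesis by simp
  qed
  then show ?thesis using field_le_epsilon[of "- trace (P ** E)" 0] by simp
qed

section \<open>Frequency responses and their gain\<close>

lemma sum_UNIV_Plus: "sum f (UNIV :: ('a::finite + 'b::finite) set) = (\<Sum>a\<in>UNIV. f (Inl a)) + (\<Sum>b\<in>UNIV. f (Inr b))"
  by (simp only: UNIV_Plus_UNIV [symmetric] sum.Plus[OF finite finite] o_def)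

lemma norm_stack:
  fixes x :: "'a::real_normed_vector^'n" and y :: "'a^'m"
  shows "(norm (\<chi> i. case i of Inl a \<Rightarrow> x $ a | Inr b \<Rightarrow> y $ b))\<^sup>2 = (norm x)\<^sup>2 + (norm y)\<^sup>2"
  by (simp add: norm_vec_def L2_set_def sum_nonneg sum_UNIV_Plus)

lemma stack_mult:
  fixes M :: "'a::comm_ring_1^'k^'n" and N :: "'a^'k^'m"
  shows "(\<chi> i j. case i of Inl a \<Rightarrow> M $ a $ j | Inr b \<Rightarrow> N $ b $ j) *v x
    = (\<chi> i. case i of Inl a \<Rightarrow> (M *v x) $ a | Inr b \<Rightarrow> (N *v x) $ b)"
  by (simp add: vec_eq_iff matrix_vector_mult_def split: sum.split)

lemma qf_SK: "qf (SK Q R K) v = qf Q v + qf R (K *v v)"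
  by (simp add: SK_def qf_add matrix_vector_mul_assoc [symmetric]) (simp add: dot_transpose inner_commute)

lemma pd_SK: "pd Q \<Longrightarrow> pd R \<Longrightarrow> pd (SK Q R K)"
  unfolding pd_def
proof (intro conjI allI impI)
  assume Q: "transpose Q = Q \<and> (\<forall>x. x \<noteq> 0 \<longrightarrow> 0 < qf Q x)"
    and R: "transpose R = R \<and> (\<forall>x. x \<noteq> 0 \<longrightarrow> 0 < qf R x)"
  then show "transpose (SK Q R K) = SK Q R K"
    by (simp add: SK_def mat_distribs matrix_transpose_mul matrix_mul_assoc)
  have "psd R" using R pd_imp_psd unfolding pd_def by blast
  then show "0 < qf (SK Q R K) x" if "x \<noteq> 0" for x
    using Q that psd_qf[of R "K *v x"] unfolding qf_SK by (simp add: add_pos_nonneg)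
qed

lemma matrix_inv_cancel:
  fixes M :: "'a::field^'n^'n"
  assumes "det M \<noteq> 0"
  shows "M ** matrix_inv M = mat 1" "matrix_inv M ** M = mat 1"
proof -
  have "\<exists>N. M ** N = mat 1 \<and> N ** M = mat 1"
    using assms invertible_det_nz unfolding invertible_def by blast
  then have "M ** matrix_inv M = mat 1 \<and> matrix_inv M ** M = mat 1"
    unfolding matrix_inv_def by (rule someI_ex)
  then show "M ** matrix_inv M = mat 1" "matrix_inv M ** M = mat 1" by auto
qed

text \<open>The weights Q^(1/2) and R^(1/2) K turn squared output norm into the form of
  \<open>SK\<close> at the state. This replaces the complex transfer matrix by the real data of
  \<open>gain_lt\<close>.\<close>

lemma Tinf_norm:
  fixes K :: "real^'n^'m"
  assumes Q: "pd Q" and R: "pd R" and K: "hurwitz (AK A B K)"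
    and v: "AK A B K *v v1 + Bw *v u1 = - (w *\<^sub>R v2)" "AK A B K *v v2 + Bw *v u2 = w *\<^sub>R v1"
  shows "(norm (Tinf A B Bw Q R K (\<i> * complex_of_real w) *v cvec u1 u2))\<^sup>2
    = qf (SK Q R K) v1 + qf (SK Q R K) v2"
proof -
  let ?s = "\<i> * complex_of_real w" and ?A = "AK A B K"
  let ?N = "mat ?s - cmat ?A"
  have "det ?N \<noteq> 0" using hurwitz_det_nz[OF K, of ?s] by simp
  note inv = matrix_inv_cancel[OF this]
  have "?N *v cvec v1 v2 = cmat Bw *v cvec u1 u2"
  proof -
    have "- (w *\<^sub>R v2) - ?A *v v1 = Bw *v u1" "w *\<^sub>R v1 - ?A *v v2 = Bw *v u2"
      using v by (simp_all add: algebra_simps)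
    moreover have "cvec a b - cvec c d = cvec (a - c) (b - d)" for a b c d :: "real^'n"
      by (simp add: cvec_def vec_eq_iff complex_eq_iff)
    ultimately show ?thesis
      by (simp add: matrix_vector_mult_diff_rdistrib mat_mult_cvec cmat_mult_cvec)
  qed
  then have "matrix_inv ?N *v (cmat Bw *v cvec u1 u2) = cvec v1 v2"
    by (metis inv(2) matrix_vector_mul_assoc matrix_vector_mul_lid)
  then have "Tinf A B Bw Q R K ?s *v cvec u1 u2 =
      (\<chi> i j. case i of Inl a \<Rightarrow> cmat (msqrt Q) $ a $ j | Inr b \<Rightarrow> cmat (msqrt R ** K) $ b $ j) *v cvec v1 v2"
    unfolding Tinf_def by (simp add: matrix_vector_mul_assoc [symmetric])
  then have "(norm (Tinf A B Bw Q R K ?s *v cvec u1 u2))\<^sup>2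
      = (norm (cmat (msqrt Q) *v cvec v1 v2))\<^sup>2 + (norm (cmat (msqrt R ** K) *v cvec v1 v2))\<^sup>2"
    by (simp only: stack_mult norm_stack)
  also have "\<dots> = qf (SK Q R K) v1 + qf (SK Q R K) v2"
    unfolding cmat_mult_cvec norm_cvec qf_SK
    by (simp add: matrix_vector_mul_assoc [symmetric] msqrt_norm Q R)
  finally show ?thesis .
qed

lemma resolvent_state_exists:
  assumes "hurwitz A"
  obtains v1 v2 where "A *v v1 + x1 = - (w *\<^sub>R v2)" "A *v v2 + x2 = w *\<^sub>R v1"
proof -
  let ?s = "\<i> * complex_of_real w"
  let ?N = "mat ?s - cmat A"
  have "det ?N \<noteq> 0" using hurwitz_det_nz[OF assms, of ?s] by simp
  note inv = matrix_inv_cancel[OF this]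
  obtain v1 v2 where v: "matrix_inv ?N *v cvec x1 x2 = cvec v1 v2" by (rule cvec_cases)
  have "?N *v cvec v1 v2 = cvec x1 x2"
    unfolding v [symmetric] by (simp add: matrix_vector_mul_assoc inv)
  moreover have "cvec a b - cvec c d = cvec (a - c) (b - d)" for a b c d :: "real^'a"
    by (simp add: cvec_def vec_eq_iff complex_eq_iff)
  ultimately have "- (w *\<^sub>R v2) - A *v v1 = x1" "w *\<^sub>R v1 - A *v v2 = x2"
    by (simp_all add: matrix_vector_mult_diff_rdistrib mat_mult_cvec cmat_mult_cvec cvec_eq_iff)
  then show ?thesis by (intro that[of v1 v2]) (auto simp: algebra_simps)
qed

text \<open>The bound does not depend on w, so it passes to the supremum over all
  frequencies.\<close>

lemma Tinf_onorm_le: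
  fixes K :: "real^'n^'m"
  assumes Q: "pd Q" and R: "pd R" and K: "hurwitz (AK A B K)"
    and X: "pd X" and t: "t > 0" and d: "d > 0"
    and sub: "psd (- riccati (AK A B K) (SK Q R K) t (d *\<^sub>R (Bw ** transpose Bw)) X)"
  shows "onorm (\<lambda>v. Tinf A B Bw Q R K (\<i> * complex_of_real w) *v v) \<le> sqrt (1 / (t * d))"
proof (rule onorm_le)
  fix x :: "complex^'n"
  obtain u1 u2 where u: "x = cvec u1 u2" by (rule cvec_cases)
  obtain v1 v2 where v: "AK A B K *v v1 + Bw *v u1 = - (w *\<^sub>R v2)" "AK A B K *v v2 + Bw *v u2 = w *\<^sub>R v1"
    using resolvent_state_exists[OF K] .
  have "t * (qf (SK Q R K) v1 + qf (SK Q R K) v2) \<le> (u1 \<bullet> u1 + u2 \<bullet> u2) / d"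
    by (rule pd_subsolution_gain[OF X d sub v])
  then have "(norm (Tinf A B Bw Q R K (\<i> * complex_of_real w) *v x))\<^sup>2 \<le> (1 / (t * d)) * (norm x)\<^sup>2"
    unfolding u Tinf_norm[OF Q R K v] norm_cvec using t d by (simp add: field_simps)
  then have "sqrt ((norm (Tinf A B Bw Q R K (\<i> * complex_of_real w) *v x))\<^sup>2) \<le> sqrt ((1 / (t * d)) * (norm x)\<^sup>2)"
    by (rule real_sqrt_le_mono)
  then show "norm (Tinf A B Bw Q R K (\<i> * complex_of_real w) *v x) \<le> sqrt (1 / (t * d)) * norm x"
    unfolding real_sqrt_mult by simp
qed

text \<open>A Lyapunov certificate tolerates a small quadratic term and a small multiple of W.
  Through \<open>Tinf_onorm_le\<close> this shows that the responses of a stable loop are bounded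
  over all frequencies.\<close>

lemma hurwitz_subsolution:
  assumes A: "hurwitz A" and S: "transpose S = S" and W: "transpose W = W"
  obtains X t d where "pd X" "t > 0" "d > 0" "psd (- riccati A S t (d *\<^sub>R W) X)"
proof -
  obtain X where X: "pd X" "pd (- lyap A X)" using hurwitz_imp_certificate[OF A] .
  have "transpose (- (X ** S ** X)) = - (X ** S ** X)"
    using pd_sym[OF X(1)] S by (simp add: transpose_minus matrix_transpose_mul matrix_mul_assoc)
  then obtain t where t: "t > 0" "\<And>s. \<bar>s\<bar> \<le> t \<Longrightarrow> pd (- lyap A X + s *\<^sub>R (- (X ** S ** X)))"
    using pd_perturb[OF X(2)] by blast
  have "pd (- lyap A X + t *\<^sub>R (- (X ** S ** X)))" using t by simp
  moreover have "transpose (- W) = - W" using W by (simp add: transpose_minus)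
  ultimately obtain d where d: "d > 0"
      "\<And>s. \<bar>s\<bar> \<le> d \<Longrightarrow> pd (- lyap A X + t *\<^sub>R (- (X ** S ** X)) + s *\<^sub>R (- W))"
    using pd_perturb by blast
  have "pd (- lyap A X + t *\<^sub>R (- (X ** S ** X)) + d *\<^sub>R (- W))" using d by simp
  then have "psd (- riccati A S t (d *\<^sub>R W) X)"
    using pd_imp_psd by (fastforce simp: riccati_def lyap_def algebra_simps)
  then show ?thesis using that X(1) t(1) d(1) by blast
qed

lemma hinf_lt_imp_gain:
  fixes K :: "real^'n^'m"
  assumes Q: "pd Q" and R: "pd R" and K: "hurwitz (AK A B K)" and \<beta>: "\<beta> > 0"
    and h: "hinf_norm A B Bw Q R K < \<beta>"
  shows "gain_lt (AK A B K) Bw (SK Q R K) (inverse (\<beta>\<^sup>2))"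
  unfolding gain_lt_def
proof (intro allI impI)
  fix w u1 u2 v1 v2
  assume u: "u1 \<noteq> 0 \<or> u2 \<noteq> 0"
    and v: "AK A B K *v v1 + Bw *v u1 = - (w *\<^sub>R v2)" "AK A B K *v v2 + Bw *v u2 = w *\<^sub>R v1"
  let ?T = "\<lambda>w::real. Tinf A B Bw Q R K (\<i> * complex_of_real w)"
  have sW: "transpose (Bw ** transpose Bw) = Bw ** transpose Bw" by (simp add: matrix_transpose_mul)
  obtain X t d where X: "pd X" "t > 0" "d > 0"
      "psd (- riccati (AK A B K) (SK Q R K) t (d *\<^sub>R (Bw ** transpose Bw)) X)"
    using hurwitz_subsolution[OF K pd_sym[OF pd_SK[OF Q R]] sW] .
  \<comment> \<open>A real supremum dominates the members of a family only if the family is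
    bounded.\<close>
  have "bdd_above (range (\<lambda>w. onorm (\<lambda>v. ?T w *v v)))"
    by (rule bdd_aboveI2) (rule Tinf_onorm_le[OF Q R K X])
  then have "onorm (\<lambda>v. ?T w *v v) \<le> hinf_norm A B Bw Q R K"
    unfolding hinf_norm_def by (rule cSUP_upper[OF UNIV_I])
  then have "onorm (\<lambda>v. ?T w *v v) < \<beta>" using h by simp
  have nz: "norm (cvec u1 u2) > 0" using u cvec_eq_0_iff by auto
  have "norm (?T w *v cvec u1 u2) \<le> onorm (\<lambda>v. ?T w *v v) * norm (cvec u1 u2)"
    by (rule onorm) (rule matrix_vector_mul_bounded_linear)
  also have "\<dots> < \<beta> * norm (cvec u1 u2)"
    using \<open>onorm (\<lambda>v. ?T w *v v) < \<beta>\<close> nz by simp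
  finally have "(norm (?T w *v cvec u1 u2))\<^sup>2 < (\<beta> * norm (cvec u1 u2))\<^sup>2"
    by (intro power_strict_mono) auto
  then show "inverse (\<beta>\<^sup>2) * (qf (SK Q R K) v1 + qf (SK Q R K) v2) < u1 \<bullet> u1 + u2 \<bullet> u2"
    unfolding Tinf_norm[OF Q R K v] power_mult_distrib norm_cvec using \<beta> by (simp add: field_simps)
qed

section \<open>Feedback gains in K_beta\<close>

lemma ric_riccati:
  "ric A B Bw Q R \<beta> K X = riccati (AK A B K) (SK Q R K) (inverse (\<beta>\<^sup>2)) (Bw ** transpose Bw) X"
  by (simp add: ric_def riccati_def)

locale hinf_design =
  fixes A :: "real^'n^'n" and B :: "real^'m^'n" and Bw :: "real^'n^'n"
    and Q :: "real^'n^'n" and R :: "real^'m^'m" and \<beta> :: real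
  assumes \<beta>: "\<beta> > 0" and Q: "pd Q" and R: "pd R" and W: "pd (Bw ** transpose Bw)"
begin

lemma Kbeta_stabilizing:
  assumes "K \<in> Kbeta A B Bw Q R \<beta>"
  obtains X where "pd X" "ric A B Bw Q R \<beta> K X = 0"
    "hurwitz (AK A B K + inverse (\<beta>\<^sup>2) *\<^sub>R (X ** SK Q R K))"
proof -
  have K: "hurwitz (AK A B K)" "hinf_norm A B Bw Q R K < \<beta>"
    using assms by (auto simp: Kbeta_def Kstab_def)
  obtain X where X: "psd X" "ric A B Bw Q R \<beta> K X = 0"
    "hurwitz (AK A B K + inverse (\<beta>\<^sup>2) *\<^sub>R (X ** SK Q R K))"
    using stabilizing_solution_exists[OF K(1) pd_SK[OF Q R] W hinf_lt_imp_gain[OF Q R K(1) \<beta> K(2)]]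
    unfolding ric_riccati by auto
  then have "pd X" using riccati_subsolution_pd[OF X(1) W] psd_zero
    unfolding ric_riccati by (metis neg_0_equal_iff_equal)
  then show ?thesis using that X by blast
qed

lemma XK_props:
  assumes K: "K \<in> Kbeta A B Bw Q R \<beta>"
  defines "X \<equiv> XK A B Bw Q R \<beta> K"
  shows "pd X" "ric A B Bw Q R \<beta> K X = 0" "hurwitz (AK A B K + inverse (\<beta>\<^sup>2) *\<^sub>R (X ** SK Q R K))"
proof -
  obtain Y where Y: "pd Y" "ric A B Bw Q R \<beta> K Y = 0"
      "hurwitz (AK A B K + inverse (\<beta>\<^sup>2) *\<^sub>R (Y ** SK Q R K))"
    using Kbeta_stabilizing[OF K] .
  have "X = Y"
    unfolding X_def XK_def
  proof (rule the_equality)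
    fix Z
    assume "transpose Z = Z \<and> ric A B Bw Q R \<beta> K Z = 0
      \<and> hurwitz (AK A B K + inverse (\<beta>\<^sup>2) *\<^sub>R (Z ** SK Q R K))"
    then have Z: "transpose Z = Z" "ric A B Bw Q R \<beta> K Z = 0"
        "hurwitz (AK A B K + inverse (\<beta>\<^sup>2) *\<^sub>R (Z ** SK Q R K))"
      by blast+
    show "Z = Y"
      by (rule stabilizing_unique[OF pd_imp_psd[OF pd_SK[OF Q R]] _ Z(1) Z(2)[unfolded ric_riccati] Z(3)
            pd_sym[OF Y(1)] Y(2)[unfolded ric_riccati] Y(3)]) simp
  qed (use Y pd_sym in auto)
  then show "pd X" "ric A B Bw Q R \<beta> K X = 0" "hurwitz (AK A B K + inverse (\<beta>\<^sup>2) *\<^sub>R (X ** SK Q R K))"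
    using Y by auto
qed

lemma Kbeta_imp_strict:
  assumes "K \<in> Kbeta A B Bw Q R \<beta>"
  obtains X where "pd X" "pd (- ric A B Bw Q R \<beta> K X)"
proof -
  obtain X where X: "pd X" "ric A B Bw Q R \<beta> K X = 0"
      "hurwitz (AK A B K + inverse (\<beta>\<^sup>2) *\<^sub>R (X ** SK Q R K))"
    using Kbeta_stabilizing[OF assms] .
  have "inverse (\<beta>\<^sup>2) \<ge> 0" by simp
  then obtain Y where "pd Y"
      "pd (- riccati (AK A B K) (SK Q R K) (inverse (\<beta>\<^sup>2)) (Bw ** transpose Bw) Y)"
    using stabilizing_imp_strict[OF pd_imp_psd[OF pd_SK[OF Q R]] _ pd_imp_psd[OF X(1)]
        X(2)[unfolded ric_riccati] X(3)] by blast
  then show ?thesis using that unfolding ric_riccati by blast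
qed

text \<open>Discarding the quadratic term and W leaves a Lyapunov certificate, so the loop is
  stable. The slack lets W grow by the factor 1 + d, which bounds the norm by beta / sqrt (1 +
  d).\<close>

lemma strict_imp_Kbeta:
  assumes X: "pd X" and sub: "pd (- ric A B Bw Q R \<beta> K X)"
  shows "K \<in> Kbeta A B Bw Q R \<beta>"
proof -
  let ?t = "inverse (\<beta>\<^sup>2)" and ?S = "SK Q R K" and ?W = "Bw ** transpose Bw"
  have t: "?t > 0" using \<beta> by simp
  have "psd (?t *\<^sub>R (X ** ?S ** X) + ?W)"
    using t by (intro psd_add psd_scaleR psd_sandwich pd_imp_psd[OF pd_SK[OF Q R]] pd_sym[OF X] pd_imp_psd[OF W]) simp
  moreover have "- lyap (AK A B K) X = - ric A B Bw Q R \<beta> K X + (?t *\<^sub>R (X ** ?S ** X) + ?W)"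
    by (simp add: ric_riccati riccati_def lyap_def)
  ultimately have "pd (- lyap (AK A B K) X)" using pd_add_psd[OF sub] by metis
  then have K: "hurwitz (AK A B K)" using X hurwitz_certificate by blast
  have "transpose (- ?W) = - ?W" using pd_sym[OF W] by (simp only: transpose_minus)
  then obtain d where d: "d > 0" "\<And>s. \<bar>s\<bar> \<le> d \<Longrightarrow> pd (- ric A B Bw Q R \<beta> K X + s *\<^sub>R (- ?W))"
    using pd_perturb[OF sub] by blast
  have "- riccati (AK A B K) ?S ?t ((1 + d) *\<^sub>R ?W) X = - ric A B Bw Q R \<beta> K X + d *\<^sub>R (- ?W)"
    unfolding riccati_perturb_W ric_riccati by simp
  then have sub': "psd (- riccati (AK A B K) ?S ?t ((1 + d) *\<^sub>R ?W) X)"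
    using pd_imp_psd[OF d(2)[of d]] d(1) by simp
  have "hinf_norm A B Bw Q R K \<le> sqrt (1 / (?t * (1 + d)))"
    unfolding hinf_norm_def
    by (rule cSUP_least) (use Tinf_onorm_le[OF Q R K X t _ sub'] d(1) in auto)
  also have "\<dots> < sqrt (\<beta>\<^sup>2)"
    using \<beta> d(1) by (intro real_sqrt_less_mono) (simp add: field_simps)
  finally show ?thesis using K \<beta> by (simp add: Kbeta_def Kstab_def)
qed

lemma XK_le:
  assumes K: "K \<in> Kbeta A B Bw Q R \<beta>" and X: "pd X" "psd (- ric A B Bw Q R \<beta> K X)"
  shows "psd (X - XK A B Bw Q R \<beta> K)"
  by (rule stabilizing_le_subsolution[OF pd_imp_psd[OF pd_SK[OF Q R]] _ pd_sym[OF XK_props(1)[OF K]]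
        XK_props(2)[OF K, unfolded ric_riccati] XK_props(3)[OF K] pd_sym[OF X(1)] X(2)[unfolded ric_riccati]]) simp

end

section \<open>The lifted set\<close>

lemma trace_cost:
  "trace ((Q2 + transpose K ** R2 ** K) ** X) = trace (Q2 ** X) + trace (R2 ** K ** X ** transpose K)"
  for Q2 :: "real^'n^'n" and K :: "real^'n^'m"
proof -
  have "trace ((transpose K ** R2 ** K) ** X) = trace (R2 ** K ** X ** transpose K)"
    using trace_mul_sym[of "transpose K" "R2 ** K ** X"] by (simp add: matrix_mul_assoc)
  then show ?thesis by (simp add: matrix_mul_add_left trace_add)
qed

lemma psd_cost: "psd Q2 \<Longrightarrow> pd R2 \<Longrightarrow> psd (Q2 + transpose K ** R2 ** K)"
  for Q2 :: "real^'n^'n" and K :: "real^'n^'m"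
proof -
  assume Q2: "psd Q2" and R2: "pd R2"
  have "qf (transpose K ** R2 ** K) x = qf R2 (K *v x)" for x
    by (simp add: matrix_vector_mul_assoc [symmetric]) (simp add: dot_transpose)
  then have "psd (transpose K ** R2 ** K)"
    using pd_imp_psd[OF R2] by (simp add: psd_def matrix_transpose_mul matrix_mul_assoc)
  then show ?thesis using Q2 by (rule psd_add[rotated])
qed

lemma convex_qf: "psd M \<Longrightarrow> 0 \<le> e \<Longrightarrow> e \<le> 1 \<Longrightarrow>
    qf M ((1 - e) *\<^sub>R x + e *\<^sub>R y) \<le> (1 - e) * qf M x + e * qf M y"
proof -
  assume M: "psd M" and e: "0 \<le> e" "e \<le> 1"
  have "(1 - e) * qf M x + e * qf M y - qf M ((1 - e) *\<^sub>R x + e *\<^sub>R y) = e * (1 - e) * qf M (x - y)"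
    using symmetric_dot[OF psd_sym[OF M], of x y]
    by (simp add: mv_distribs inner_add_left inner_add_right inner_diff_left inner_diff_right algebra_simps)
  moreover have "0 \<le> e * (1 - e) * qf M (x - y)" using e psd_qf[OF M] by simp
  ultimately show ?thesis by linarith
qed

text \<open>K enters only through Y = KX: the expression is affine in X and Y plus psd forms of Xx
  and Yx. This is the change of variables that makes the constraint convex.\<close>

lemma qf_ric:
  fixes X :: "real^'n^'n" and K :: "real^'n^'m"
  assumes X: "transpose X = X"
  shows "qf (ric A B Bw Q R \<beta> K X) x =
    2 * ((x v* A) \<bullet> (X *v x)) + 2 * ((x v* B) \<bullet> ((K ** X) *v x))
    + inverse (\<beta>\<^sup>2) * (qf Q (X *v x) + qf R ((K ** X) *v x)) + qf (Bw ** transpose Bw) x"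
proof -
  have "(x v* AK A B K) \<bullet> (X *v x) = (x v* A) \<bullet> (X *v x) + (x v* B) \<bullet> ((K ** X) *v x)"
    by (simp add: AK_def vector_matrix_mult_add_rdistrib inner_add_left
        vector_matrix_mul_assoc [symmetric] dot_lmul_matrix matrix_vector_mul_assoc [symmetric])
  then show ?thesis
    unfolding ric_riccati qf_riccati[OF X] qf_SK
    by (simp add: matrix_vector_mul_assoc [symmetric])
qed

lemma transpose_ric:
  "transpose X = X \<Longrightarrow> transpose Q = Q \<Longrightarrow> transpose R = R \<Longrightarrow>
    transpose (ric A B Bw Q R \<beta> K X) = ric A B Bw Q R \<beta> K X"
  unfolding ric_riccati
  by (intro transpose_riccati)
    (simp_all add: SK_def mat_distribs matrix_transpose_mul matrix_mul_assoc)

context hinf_design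
begin

lemma Llft_iff:
  "(K, \<gamma>, X) \<in> Llft A B Bw Q R \<beta> Q2 R2 \<longleftrightarrow>
    pd X \<and> trace ((Q2 + transpose K ** R2 ** K) ** X) \<le> \<gamma> \<and> psd (- ric A B Bw Q R \<beta> K X)"
  unfolding trace_cost Llft_def nsd_def by auto

lemma epi_subset_proj:
  "epi_Jmix A B Bw Q R \<beta> Q2 R2 \<subseteq> proj_Kgamma (Llft A B Bw Q R \<beta> Q2 R2)"
proof (clarsimp simp: epi_Jmix_def proj_Kgamma_def)
  fix K \<gamma>
  assume K: "K \<in> Kbeta A B Bw Q R \<beta>" and J: "Jmix A B Bw Q R \<beta> Q2 R2 K \<le> \<gamma>"
  have "(K, \<gamma>, XK A B Bw Q R \<beta> K) \<in> Llft A B Bw Q R \<beta> Q2 R2"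
    unfolding Llft_iff using XK_props[OF K] J by (simp add: psd_zero Jmix_def)
  then show "\<exists>X. (K, \<gamma>, X) \<in> Llft A B Bw Q R \<beta> Q2 R2" ..
qed

lemma closed_proj: "closed (proj_Kgamma (Llft A B Bw Q R \<beta> Q2 R2))"
  unfolding closed_sequential_limits
proof (intro allI impI)
  fix x l
  assume "(\<forall>n. x n \<in> proj_Kgamma (Llft A B Bw Q R \<beta> Q2 R2)) \<and> x \<longlonglongrightarrow> l"
  then have x: "\<And>n. x n \<in> proj_Kgamma (Llft A B Bw Q R \<beta> Q2 R2)" and l: "x \<longlonglongrightarrow> l" by auto
  define K \<gamma> where "K n = fst (x n)" and "\<gamma> n = snd (x n)" for n
  have K: "K \<longlonglongrightarrow> fst l" and \<gamma>: "\<gamma> \<longlonglongrightarrow> snd l"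
    unfolding K_def \<gamma>_def using l by (auto intro: tendsto_fst tendsto_snd)
  have "\<exists>X. (K n, \<gamma> n, X) \<in> Llft A B Bw Q R \<beta> Q2 R2" for n
    using x[of n] by (simp add: proj_Kgamma_def K_def \<gamma>_def case_prod_beta)
  then obtain X where X: "\<And>n. (K n, \<gamma> n, X n) \<in> Llft A B Bw Q R \<beta> Q2 R2" by metis
  note X = X[unfolded Llft_iff]
  have pX: "psd (X n)" for n using X pd_imp_psd by blast
  obtain c where c: "c > 0" "\<And>v. c * (v \<bullet> v) \<le> qf Q v" using pd_lower[OF Q] by blast
  have "(\<lambda>n. transpose (AK A B (K n))) \<longlonglongrightarrow> transpose (AK A B (fst l))"
    unfolding AK_def by (intro tendsto_intros matrix_tendsto_intros K)
  then have "bounded (range (\<lambda>n. transpose (AK A B (K n))))" by (rule convergent_imp_bounded)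
  then obtain a where a: "\<And>n. norm (transpose (AK A B (K n))) \<le> a" by (auto simp: bounded_iff)
  define C where "C = real CARD('n) * (real CARD('n) * (real CARD('n) * (2 * a / (inverse (\<beta>\<^sup>2) * c))))"
  have "norm (X n) \<le> C" for n
  proof -
    \<comment> \<open>One lower bound serves all gains, because K^T R K only adds to Q. The trace
      bound then varies with n only through A + BK.\<close>
    have "c * (v \<bullet> v) \<le> qf (SK Q R (K n)) v" for v
      unfolding qf_SK using c(2)[of v] psd_qf[OF pd_imp_psd[OF R], of "K n *v v"] by linarith
    then have "trace (X n) \<le> real CARD('n) * (2 * norm (transpose (AK A B (K n))) / (inverse (\<beta>\<^sup>2) * c))"
      using X[of n] \<beta> unfolding ric_riccati
      by (intro riccati_subsolution_trace_bound[OF pX _ pd_imp_psd[OF W] _ c(1)]) auto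
    also have "\<dots> \<le> real CARD('n) * (2 * a / (inverse (\<beta>\<^sup>2) * c))"
      using a c(1) by (intro mult_left_mono divide_right_mono) auto
    finally have "real CARD('n) * (real CARD('n) * trace (X n)) \<le> C"
      unfolding C_def by (intro mult_left_mono) auto
    then show ?thesis using psd_norm_le_trace[OF pX[of n]] by linarith
  qed
  then have "bounded (range X)" by (auto simp: bounded_iff)
  then obtain X0 r where r: "strict_mono (r :: nat \<Rightarrow> nat)" "(X \<circ> r) \<longlonglongrightarrow> X0"
    using bounded_imp_convergent_subsequence by blast
  have Kr: "(K \<circ> r) \<longlonglongrightarrow> fst l" and \<gamma>r: "(\<gamma> \<circ> r) \<longlonglongrightarrow> snd l"
    using K \<gamma> r(1) by (auto intro: LIMSEQ_subseq_LIMSEQ)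
  have pX0: "psd X0" by (rule tendsto_psd[OF _ r(2)]) (simp add: pX)
  have "(\<lambda>n. - ric A B Bw Q R \<beta> ((K \<circ> r) n) ((X \<circ> r) n)) \<longlonglongrightarrow> - ric A B Bw Q R \<beta> (fst l) X0"
    unfolding ric_riccati AK_def SK_def
    by (intro tendsto_minus tendsto_riccati tendsto_intros matrix_tendsto_intros Kr r(2))
  then have sub: "psd (- ric A B Bw Q R \<beta> (fst l) X0)"
    by (rule tendsto_psd[rotated]) (use X in auto)
  \<comment> \<open>A limit of positive definite matrices is only psd; the W term restores
    definiteness.\<close>
  have "pd X0" using riccati_subsolution_pd[OF pX0 W] sub unfolding ric_riccati by blast
  moreover have "trace ((Q2 + transpose (fst l) ** R2 ** fst l) ** X0) \<le> snd l"
  proof (rule LIMSEQ_le[OF _ \<gamma>r])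
    show "(\<lambda>n. trace ((Q2 + transpose ((K \<circ> r) n) ** R2 ** (K \<circ> r) n) ** (X \<circ> r) n))
        \<longlonglongrightarrow> trace ((Q2 + transpose (fst l) ** R2 ** fst l) ** X0)"
      unfolding trace_def
      by (intro tendsto_sum tendsto_vec_nth tendsto_intros matrix_tendsto_intros Kr r(2))
    show "\<exists>N. \<forall>n\<ge>N. trace ((Q2 + transpose ((K \<circ> r) n) ** R2 ** (K \<circ> r) n) ** (X \<circ> r) n) \<le> (\<gamma> \<circ> r) n"
      using X by auto
  qed
  ultimately have "(fst l, snd l, X0) \<in> Llft A B Bw Q R \<beta> Q2 R2" unfolding Llft_iff using sub by blast
  then show "l \<in> proj_Kgamma (Llft A B Bw Q R \<beta> Q2 R2)"
    by (auto simp: proj_Kgamma_def split: prod.splits)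
qed

text \<open>In the variables (X, KX) the Riccati form is convex, so mixing in a strictly feasible point makes
  the inequality strict.\<close>
lemma strict_mixture:
  assumes X: "pd X" "psd (- ric A B Bw Q R \<beta> K X)"
    and X1: "pd X1" "pd (- ric A B Bw Q R \<beta> K1 X1)"
    and e: "0 < e" "e \<le> 1"
  defines "Z \<equiv> (1 - e) *\<^sub>R X + e *\<^sub>R X1"
  defines "L \<equiv> ((1 - e) *\<^sub>R (K ** X) + e *\<^sub>R (K1 ** X1)) ** matrix_inv Z"
  shows "pd Z" "pd (- ric A B Bw Q R \<beta> L Z)"
proof -
  have "psd ((1 - e) *\<^sub>R X)" using e pd_imp_psd[OF X(1)] by (intro psd_scaleR) auto
  then show Z: "pd Z" unfolding Z_def using pd_add_psd[OF pd_scaleR[OF X1(1) e(1)]] by (metis add.commute)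
  have inv: "matrix_inv Z ** Z = mat 1"
    using pd_imp_invertible[OF Z] invertible_det_nz matrix_inv_cancel(2) by blast
  have LZ: "L ** Z = (1 - e) *\<^sub>R (K ** X) + e *\<^sub>R (K1 ** X1)"
    unfolding L_def by (simp add: matrix_mul_assoc [symmetric] inv)
  show "pd (- ric A B Bw Q R \<beta> L Z)"
    unfolding pd_def
  proof (intro conjI allI impI)
    show "transpose (- ric A B Bw Q R \<beta> L Z) = - ric A B Bw Q R \<beta> L Z"
      using transpose_ric[OF pd_sym[OF Z] pd_sym[OF Q] pd_sym[OF R]] by (simp add: transpose_minus)
    fix x :: "real^'n" assume x: "x \<noteq> 0"
    let ?b = "inverse (\<beta>\<^sup>2)"
    have v: "Z *v x = (1 - e) *\<^sub>R (X *v x) + e *\<^sub>R (X1 *v x)"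
      "(L ** Z) *v x = (1 - e) *\<^sub>R ((K ** X) *v x) + e *\<^sub>R ((K1 ** X1) *v x)"
      unfolding LZ by (simp_all add: Z_def mv_distribs)
    have "?b * (qf Q (Z *v x) + qf R ((L ** Z) *v x))
        \<le> ?b * (((1 - e) * qf Q (X *v x) + e * qf Q (X1 *v x))
               + ((1 - e) * qf R ((K ** X) *v x) + e * qf R ((K1 ** X1) *v x)))"
      unfolding v using e by (intro mult_left_mono add_mono convex_qf pd_imp_psd Q R) auto
    then have "qf (ric A B Bw Q R \<beta> L Z) x
        \<le> (1 - e) * qf (ric A B Bw Q R \<beta> K X) x + e * qf (ric A B Bw Q R \<beta> K1 X1) x"
      unfolding qf_ric[OF pd_sym[OF Z]] qf_ric[OF pd_sym[OF X(1)]] qf_ric[OF pd_sym[OF X1(1)]]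
      by (simp add: v inner_add_right algebra_simps)
    also have "\<dots> < 0"
    proof -
      have "(1 - e) * qf (ric A B Bw Q R \<beta> K X) x \<le> 0"
        using psd_qf[OF X(2), of x] e by (intro mult_nonneg_nonpos) (auto simp: qf_minus)
      moreover have "e * qf (ric A B Bw Q R \<beta> K1 X1) x < 0"
        using pd_qf[OF X1(2) x] e by (intro mult_pos_neg) (auto simp: qf_minus)
      ultimately show ?thesis by linarith
    qed
    finally show "0 < qf (- ric A B Bw Q R \<beta> L Z) x" by (simp add: qf_minus)
  qed
qed

end

section \<open>Smoothness of matrix inversion\<close>

lemma continuous_on_det:
  "continuous_on S f \<Longrightarrow> continuous_on S (\<lambda>x. det (f x :: real^'n^'n))"
  unfolding det_def by (intro continuous_intros)

text \<open>Cramer's rule: the entries are quotients of determinants, from which continuity of the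
  inverse follows.\<close>

lemma matrix_inv_entry:
  fixes M :: "real^'n^'n"
  assumes "det M \<noteq> 0"
  shows "matrix_inv M $ k $ j = det (\<chi> i l. if l = k then axis j 1 $ i else M $ i $ l) / det M"
proof -
  have "M *v (matrix_inv M *v axis j 1) = axis j 1"
    using matrix_inv_cancel(1)[OF assms] by (simp add: matrix_vector_mul_assoc)
  then have "matrix_inv M *v axis j 1 = (\<chi> k. det (\<chi> i l. if l = k then axis j 1 $ i else M $ i $ l) / det M)"
    using cramer[OF assms] by blast
  moreover have "(matrix_inv M *v axis j 1) $ k = matrix_inv M $ k $ j"
    by (simp add: matrix_vector_mult_basis column_def)
  ultimately show ?thesis by simp
qed

lemma continuous_on_matrix_inv:
  fixes f :: "'a::topological_space \<Rightarrow> real^'n^'n"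
  assumes f: "continuous_on S f" and inv: "\<And>x. x \<in> S \<Longrightarrow> det (f x) \<noteq> 0"
  shows "continuous_on S (\<lambda>x. matrix_inv (f x))"
proof -
  have "continuous_on S (\<lambda>x. \<chi> k j. det (\<chi> i l. if l = k then axis j 1 $ i else f x $ i $ l) / det (f x))"
  proof (intro continuous_on_vec_lambda continuous_on_divide continuous_on_det ballI inv f)
    fix i l k j
    show "continuous_on S (\<lambda>x. if l = k then axis j 1 $ i else f x $ i $ l)"
      by (cases "l = k") (auto intro!: continuous_intros f)
  qed
  then show ?thesis
    by (rule continuous_on_eq) (simp add: vec_eq_iff matrix_inv_entry inv)
qed

lemma open_det_nz: "open {M :: real^'n^'n. det M \<noteq> 0}"
  by (intro open_Collect_neq continuous_on_det continuous_intros)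

text \<open>The error of the linear approximation is exactly (M^-1 - N^-1)(N - M)M^-1. Divided by |N
  - M| it tends to 0 by continuity of the inverse.\<close>

lemma has_derivative_matrix_inv:
  fixes M :: "real^'n^'n"
  assumes M: "det M \<noteq> 0"
  shows "(matrix_inv has_derivative (\<lambda>H. - (matrix_inv M ** H ** matrix_inv M))) (at M)"
proof -
  let ?I = "matrix_inv :: real^'n^'n \<Rightarrow> real^'n^'n"
  obtain C where C: "\<And>(P :: real^'n^'n) (N :: real^'n^'n). norm (P ** N) \<le> norm P * norm N * C" "C > 0"
    using bounded_bilinear.pos_bounded[OF bounded_bilinear_matrix_mul] by blast
  obtain e where e: "e > 0" "\<And>N. dist N M < e \<Longrightarrow> det N \<noteq> 0"
    using open_det_nz M unfolding open_dist by blast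
  have "continuous_on {M :: real^'n^'n. det M \<noteq> 0} ?I"
    by (rule continuous_on_matrix_inv) (auto intro: continuous_intros)
  then have "(?I \<longlongrightarrow> ?I M) (at M)"
    using M continuous_on_eq_continuous_at[OF open_det_nz] by (auto simp: isCont_def)
  then have "((\<lambda>N. norm (?I M - ?I N) * (C * norm (?I M) * C)) \<longlongrightarrow> norm (?I M - ?I M) * (C * norm (?I M) * C)) (at M)"
    by (intro tendsto_intros)
  then have lim: "((\<lambda>N. norm (?I M - ?I N) * (C * norm (?I M) * C)) \<longlongrightarrow> 0) (at M)" by simp
  show ?thesis
  proof (rule has_derivativeI_sandwich[OF e(1) _ _ lim])
    show "bounded_linear (\<lambda>H. - (?I M ** H ** ?I M))"
      unfolding linear_conv_bounded_linear [symmetric] by (rule linearI) (simp_all add: mat_distribs)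
    fix N assume "N \<noteq> M" "dist N M < e"
    then have N: "det N \<noteq> 0" and nz: "norm (N - M) > 0" using e by auto
    note iM = matrix_inv_cancel[OF M] and iN = matrix_inv_cancel[OF N]
    have a: "?I N ** (N - M) ** ?I M = ?I M - ?I N"
      by (simp add: matrix_mul_diff_right matrix_mul_diff_left iN)
        (simp add: matrix_mul_assoc [symmetric] iM)
    have "?I N - ?I M - - (?I M ** (N - M) ** ?I M) = (?I M - ?I N) ** (N - M) ** ?I M"
      unfolding matrix_mul_diff_left[of "?I M" "?I N"]
      by (subst matrix_mul_diff_left) (simp add: a)
    also have "norm \<dots> \<le> norm ((?I M - ?I N) ** (N - M)) * norm (?I M) * C" by (rule C)
    also have "\<dots> \<le> (norm (?I M - ?I N) * norm (N - M) * C) * norm (?I M) * C"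
      using C by (intro mult_right_mono) auto
    finally show "norm (?I N - ?I M - - (?I M ** (N - M) ** ?I M)) / norm (N - M)
        \<le> norm (?I M - ?I N) * (C * norm (?I M) * C)"
      using nz by (simp add: field_simps)
  qed
qed

section \<open>Calculus of C^k functions\<close>

lemma frechet_derivative_cong_open:
  assumes "open S" "x \<in> S" "\<And>y. y \<in> S \<Longrightarrow> f y = g y"
  shows "frechet_derivative f (at x) = frechet_derivative g (at x)"
proof -
  have "(f has_derivative D) (at x) \<longleftrightarrow> (g has_derivative D) (at x)" for D
    using has_derivative_transform_within_open[of _ D x UNIV S] assms by metis
  then show ?thesis unfolding frechet_derivative_def by simp
qed

lemma Ck_cong:
  assumes S: "open S" and eq: "\<And>x. x \<in> S \<Longrightarrow> f x = g x" and f: "Ck k S f"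
  shows "Ck k S g"
  using eq f
proof (induction k arbitrary: f g)
  case 0
  then show ?case by (auto intro: continuous_on_eq)
next
  case (Suc k)
  have "g differentiable_on S"
    using Suc.prems by (auto simp: differentiable_on_def intro: differentiable_transform_within[OF _ zero_less_one])
  moreover have "Ck k S (\<lambda>x. frechet_derivative g (at x) h)" for h
  proof (rule Suc.IH)
    show "Ck k S (\<lambda>x. frechet_derivative f (at x) h)" using Suc.prems(2) by simp
    show "frechet_derivative f (at x) h = frechet_derivative g (at x) h" if "x \<in> S" for x
      using frechet_derivative_cong_open[OF S that Suc.prems(1)] by simp
  qed
  ultimately show ?case by simp
qed

text \<open>\<open>Ck\<close> is stated with the chosen \<open>frechet_derivative\<close>. At points
  of an open set derivatives are unique, so an explicit formula D may stand in for it.\<close>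

lemma Ck_SucI:
  assumes S: "open S" and f: "\<And>x. x \<in> S \<Longrightarrow> (f has_derivative D x) (at x)"
    and D: "\<And>h. Ck k S (\<lambda>x. D x h)"
  shows "Ck (Suc k) S f"
  unfolding Ck.simps
proof (intro conjI allI)
  show "f differentiable_on S"
    using f by (auto simp: differentiable_on_def differentiable_def intro: has_derivative_at_withinI)
  fix h
  show "Ck k S (\<lambda>x. frechet_derivative f (at x) h)"
  proof (rule Ck_cong[OF S _ D])
    show "D x h = frechet_derivative f (at x) h" if "x \<in> S" for x
      using frechet_derivative_at[OF f[OF that]] by simp
  qed
qed

lemma Ck_Suc_derivative:
  assumes "open S" "Ck (Suc k) S f" "x \<in> S"
  shows "(f has_derivative frechet_derivative f (at x)) (at x)"
  using assms by (auto simp: differentiable_on_eq_differentiable_at frechet_derivative_works)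

lemma Ck_Suc_imp_Ck: "open S \<Longrightarrow> Ck (Suc k) S f \<Longrightarrow> Ck k S f"
  by (induction k arbitrary: f) (auto intro: differentiable_imp_continuous_on)

lemma Ck_const: "open S \<Longrightarrow> Ck k S (\<lambda>x. c)"
  by (induction k arbitrary: c) (auto intro!: continuous_intros Ck_SucI[where D = "\<lambda>_ _. 0"] simp del: Ck.simps(2))

lemma Ck_bounded_linear:
  assumes "open S" "bounded_linear f"
  shows "Ck k S f"
proof (cases k)
  case 0
  then show ?thesis using assms by (auto intro: linear_continuous_on)
next
  case (Suc j)
  show ?thesis unfolding Suc
    by (rule Ck_SucI[OF assms(1), where D = "\<lambda>_. f"])
      (auto intro: bounded_linear_imp_has_derivative assms Ck_const)
qed

lemma Ck_add:
  assumes "open S" "Ck k S f" "Ck k S g"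
  shows "Ck k S (\<lambda>x. f x + g x)"
  using assms(2,3)
proof (induction k arbitrary: f g)
  case 0
  then show ?case by (auto intro: continuous_intros)
next
  case (Suc k)
  show ?case
  proof (rule Ck_SucI[OF assms(1)])
    show "((\<lambda>x. f x + g x) has_derivative
        (\<lambda>h. frechet_derivative f (at x) h + frechet_derivative g (at x) h)) (at x)" if "x \<in> S" for x
      using Ck_Suc_derivative[OF assms(1) Suc.prems(1) that] Ck_Suc_derivative[OF assms(1) Suc.prems(2) that]
      by (rule has_derivative_add)
    show "Ck k S (\<lambda>x. frechet_derivative f (at x) h + frechet_derivative g (at x) h)" for h
      using Suc.prems by (intro Suc.IH) auto
  qed
qed

lemma Ck_linear_comp:
  assumes "open S" "bounded_linear L" "Ck k S f"
  shows "Ck k S (\<lambda>x. L (f x))"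
  using assms(3)
proof (induction k arbitrary: f)
  case 0
  then show ?case by (auto intro: bounded_linear.continuous_on[OF assms(2)])
next
  case (Suc k)
  show ?case
  proof (rule Ck_SucI[OF assms(1)])
    show "((\<lambda>x. L (f x)) has_derivative (\<lambda>h. L (frechet_derivative f (at x) h))) (at x)" if "x \<in> S" for x
      using Ck_Suc_derivative[OF assms(1) Suc.prems that] by (rule bounded_linear.has_derivative[OF assms(2)])
    show "Ck k S (\<lambda>x. L (frechet_derivative f (at x) h))" for h
      using Suc.prems by (intro Suc.IH) auto
  qed
qed

lemma Ck_bilinear:
  assumes "open S" "bounded_bilinear b" "Ck k S f" "Ck k S g"
  shows "Ck k S (\<lambda>x. b (f x) (g x))"
  using assms(3,4)
proof (induction k arbitrary: f g)
  case 0
  then show ?case by (auto intro: bounded_bilinear.continuous_on[OF assms(2)])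
next
  case (Suc k)
  show ?case
  proof (rule Ck_SucI[OF assms(1)])
    show "((\<lambda>x. b (f x) (g x)) has_derivative
        (\<lambda>h. b (f x) (frechet_derivative g (at x) h) + b (frechet_derivative f (at x) h) (g x))) (at x)"
      if "x \<in> S" for x
      using Ck_Suc_derivative[OF assms(1) Suc.prems(1) that] Ck_Suc_derivative[OF assms(1) Suc.prems(2) that]
      by (rule bounded_bilinear.FDERIV[OF assms(2)])
    show "Ck k S (\<lambda>x. b (f x) (frechet_derivative g (at x) h) + b (frechet_derivative f (at x) h) (g x))" for h
    proof (intro Ck_add[OF assms(1)] Suc.IH)
      show "Ck k S f" "Ck k S g" using Suc.prems Ck_Suc_imp_Ck[OF assms(1)] by blast+
      show "Ck k S (\<lambda>x. frechet_derivative f (at x) h)" "Ck k S (\<lambda>x. frechet_derivative g (at x) h)"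
        using Suc.prems by auto
    qed
  qed
qed

lemma Ck_Pair:
  assumes "open S" "Ck k S f" "Ck k S g"
  shows "Ck k S (\<lambda>x. (f x, g x))"
proof -
  have "Ck k S (\<lambda>x. (f x, 0) + (0, g x))"
    by (intro Ck_add assms Ck_linear_comp[where L = "\<lambda>a. (a, 0)"] Ck_linear_comp[where L = "\<lambda>a. (0, a)"]
        bounded_linear_Pair bounded_linear_ident bounded_linear_zero)
  then show ?thesis by simp
qed

text \<open>The derivative is built from the inverse itself and the derivative of f by products, so
  smoothness of order k of the inverse yields order k + 1.\<close>

lemma Ck_matrix_inv:
  fixes f :: "'a::real_normed_vector \<Rightarrow> real^'n^'n"
  assumes S: "open S" and inv: "\<And>x. x \<in> S \<Longrightarrow> det (f x) \<noteq> 0" and f: "Ck k S f"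
  shows "Ck k S (\<lambda>x. matrix_inv (f x))"
  using f
proof (induction k)
  case 0
  then show ?case using inv by (auto intro: continuous_on_matrix_inv)
next
  case (Suc k)
  have fk: "Ck k S (\<lambda>x. matrix_inv (f x))" using Suc Ck_Suc_imp_Ck[OF S] by blast
  show ?case
  proof (rule Ck_SucI[OF S])
    show "((\<lambda>x. matrix_inv (f x)) has_derivative
        (\<lambda>h. - (matrix_inv (f x) ** frechet_derivative f (at x) h ** matrix_inv (f x)))) (at x)"
      if x: "x \<in> S" for x
      using has_derivative_compose[OF Ck_Suc_derivative[OF S Suc.prems x] has_derivative_matrix_inv[OF inv[OF x]]] .
    show "Ck k S (\<lambda>x. - (matrix_inv (f x) ** frechet_derivative f (at x) h ** matrix_inv (f x)))" for h
      using Suc.prems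
      by (intro Ck_linear_comp[OF S bounded_linear_minus[OF bounded_linear_ident]]
          Ck_bilinear[OF S bounded_bilinear_matrix_mul] fk) auto
  qed
qed

section \<open>Closure and diffeomorphism\<close>

context hinf_design
begin

lemma proj_subset_closure:
  assumes Q2: "psd Q2" and R2: "pd R2" and ne: "Kbeta A B Bw Q R \<beta> \<noteq> {}"
  shows "proj_Kgamma (Llft A B Bw Q R \<beta> Q2 R2) \<subseteq> closure (epi_Jmix A B Bw Q R \<beta> Q2 R2)"
proof
  fix p assume "p \<in> proj_Kgamma (Llft A B Bw Q R \<beta> Q2 R2)"
  then obtain K \<gamma> X where p: "p = (K, \<gamma>)" and L: "(K, \<gamma>, X) \<in> Llft A B Bw Q R \<beta> Q2 R2"
    by (auto simp: proj_Kgamma_def)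
  let ?cost = "\<lambda>K X. trace ((Q2 + transpose K ** R2 ** K) ** X)"
  have X: "pd X" "psd (- ric A B Bw Q R \<beta> K X)" and cost: "?cost K X \<le> \<gamma>"
    using L unfolding Llft_iff by auto
  obtain K1 X1 where X1: "pd X1" "pd (- ric A B Bw Q R \<beta> K1 X1)"
    using ne Kbeta_imp_strict by blast
  define e where "e n = 1 / real (Suc n)" for n
  have e: "0 < e n" "e n \<le> 1" for n by (auto simp: e_def)
  have elim: "e \<longlonglongrightarrow> 0" unfolding e_def by (rule LIMSEQ_Suc[OF lim_1_over_n])
  define Z where "Z n = (1 - e n) *\<^sub>R X + e n *\<^sub>R X1" for n
  define Y where "Y n = (1 - e n) *\<^sub>R (K ** X) + e n *\<^sub>R (K1 ** X1)" for n
  define L where "L n = Y n ** matrix_inv (Z n)" for n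
  have Z: "pd (Z n)" and sub: "pd (- ric A B Bw Q R \<beta> (L n) (Z n))" for n
    using strict_mixture[OF X X1 e[of n]] by (simp_all add: Z_def Y_def L_def)
  have LK: "L n \<in> Kbeta A B Bw Q R \<beta>" for n using strict_imp_Kbeta[OF Z sub] .
  have detX: "det X \<noteq> 0" using pd_imp_invertible[OF X(1)] invertible_det_nz by blast
  have Zlim: "Z \<longlonglongrightarrow> X"
  proof -
    have "Z \<longlonglongrightarrow> (1 - 0) *\<^sub>R X + 0 *\<^sub>R X1" unfolding Z_def by (intro tendsto_intros elim)
    then show ?thesis by simp
  qed
  have Ylim: "Y \<longlonglongrightarrow> K ** X"
  proof -
    have "Y \<longlonglongrightarrow> (1 - 0) *\<^sub>R (K ** X) + 0 *\<^sub>R (K1 ** X1)" unfolding Y_def by (intro tendsto_intros elim)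
    then show ?thesis by simp
  qed
  have "continuous_on {M :: real^'n^'n. det M \<noteq> 0} matrix_inv"
    by (rule continuous_on_matrix_inv) (auto intro: continuous_intros)
  then have "isCont matrix_inv X"
    using detX continuous_on_eq_continuous_at[OF open_det_nz] by blast
  then have "(\<lambda>n. matrix_inv (Z n)) \<longlonglongrightarrow> matrix_inv X" using Zlim by (rule isCont_tendsto_compose)
  then have "L \<longlonglongrightarrow> K ** X ** matrix_inv X"
    unfolding L_def by (intro matrix_tendsto_intros Ylim)
  also have "K ** X ** matrix_inv X = K"
    by (simp add: matrix_mul_assoc [symmetric] matrix_inv_cancel(1)[OF detX])
  finally have Llim: "L \<longlonglongrightarrow> K" .
  \<comment> \<open>The slack of the given point is carried along, so that g tends to \<gamma> while
    staying above the cost.\<close>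
  define g where "g n = ?cost (L n) (Z n) + (\<gamma> - ?cost K X)" for n
  have "g \<longlonglongrightarrow> ?cost K X + (\<gamma> - ?cost K X)"
    unfolding g_def trace_def
    by (intro tendsto_add tendsto_const tendsto_sum tendsto_vec_nth matrix_tendsto_intros Llim Zlim)
  then have glim: "g \<longlonglongrightarrow> \<gamma>" by simp
  have epi: "(L n, g n) \<in> epi_Jmix A B Bw Q R \<beta> Q2 R2" for n
  proof -
    \<comment> \<open>Z n need not solve the Riccati equation. It lies above the stabilizing
      solution, and the cost is monotone because its weight is psd.\<close>
    have "psd (Z n - XK A B Bw Q R \<beta> (L n))" using XK_le[OF LK Z] sub pd_imp_psd by blast
    from psd_trace_mul_nonneg[OF psd_cost[OF Q2 R2, of "L n"] this]
    have "Jmix A B Bw Q R \<beta> Q2 R2 (L n) \<le> ?cost (L n) (Z n)"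
      by (simp add: Jmix_def matrix_mul_diff_right trace_sub)
    also have "\<dots> \<le> g n" using cost by (simp add: g_def)
    finally show ?thesis using LK by (simp add: epi_Jmix_def)
  qed
  have "(\<lambda>n. (L n, g n)) \<longlonglongrightarrow> (K, \<gamma>)" using Llim glim by (rule tendsto_Pair)
  then show "p \<in> closure (epi_Jmix A B Bw Q R \<beta> Q2 R2)"
    unfolding closure_sequential p using epi by (intro exI[of _ "\<lambda>n. (L n, g n)"]) simp
qed

lemma proj_eq_closure:
  assumes "psd Q2" "pd R2" "Kbeta A B Bw Q R \<beta> \<noteq> {}"
  shows "proj_Kgamma (Llft A B Bw Q R \<beta> Q2 R2) = closure (epi_Jmix A B Bw Q R \<beta> Q2 R2)"
  using proj_subset_closure[OF assms] closure_minimal[OF epi_subset_proj closed_proj] by blast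

end

section \<open>Schur complement of the block matrix\<close>

lemma Fcvx_mat_qf:
  fixes X :: "real^'n^'n" and Y :: "real^'n^'m" and z :: "real^('n + ('n + 'm))"
  assumes X: "transpose X = X" and Q: "pd Q" and R: "pd R"
  defines "x \<equiv> \<chi> i. z $ Inl i" and "y \<equiv> \<chi> i. z $ Inr (Inl i)" and "w \<equiv> \<chi> i. z $ Inr (Inr i)"
  shows "qf (Fcvx_mat A B Bw Q R \<beta> X Y) z =
    2 * ((x v* A) \<bullet> (X *v x)) + 2 * ((x v* B) \<bullet> (Y *v x)) + qf (Bw ** transpose Bw) x
    + 2 * (y \<bullet> (msqrt Q *v (X *v x))) + 2 * (w \<bullet> (msqrt R *v (Y *v x))) - \<beta>\<^sup>2 * (y \<bullet> y) - \<beta>\<^sup>2 * (w \<bullet> w)"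
proof -
  let ?F = "Fcvx_mat A B Bw Q R \<beta> X Y" and ?Q = "msqrt Q" and ?R = "msqrt R"
  let ?M = "A ** X + X ** transpose A + B ** Y + transpose Y ** transpose B + Bw ** transpose Bw"
  have sQ: "transpose ?Q = ?Q" and sR: "transpose ?R = ?R" using msqrt_props(1) Q R psd_sym by blast+
  have "(?F *v z) $ Inl i = (?M *v x + (X ** ?Q) *v y + (transpose Y ** ?R) *v w) $ i" for i
    unfolding Fcvx_mat_def Let_def x_def y_def w_def
    by (simp add: matrix_vector_mult_def sum_UNIV_Plus)
  moreover have "(?F *v z) $ Inr (Inl i) = ((?Q ** X) *v x - \<beta>\<^sup>2 *\<^sub>R y) $ i" for i
    unfolding Fcvx_mat_def Let_def x_def y_def
    by (simp add: matrix_vector_mult_def sum_UNIV_Plus if_distrib if_distribR cong: if_cong)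
  moreover have "(?F *v z) $ Inr (Inr i) = ((?R ** Y) *v x - \<beta>\<^sup>2 *\<^sub>R w) $ i" for i
    unfolding Fcvx_mat_def Let_def x_def w_def
    by (simp add: matrix_vector_mult_def sum_UNIV_Plus if_distrib if_distribR cong: if_cong)
  ultimately have "qf ?F z = x \<bullet> (?M *v x + (X ** ?Q) *v y + (transpose Y ** ?R) *v w)
      + y \<bullet> ((?Q ** X) *v x - \<beta>\<^sup>2 *\<^sub>R y) + w \<bullet> ((?R ** Y) *v x - \<beta>\<^sup>2 *\<^sub>R w)"
    unfolding inner_vec_def[of z] sum_UNIV_Plus inner_vec_def[of x] inner_vec_def[of y] inner_vec_def[of w]
    by (simp add: x_def y_def w_def)
  moreover have "qf ?M x = 2 * ((x v* A) \<bullet> (X *v x)) + 2 * ((x v* B) \<bullet> (Y *v x)) + qf (Bw ** transpose Bw) x"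
  proof -
    have "qf (A ** X + X ** transpose A) x = 2 * ((x v* A) \<bullet> (X *v x))"
      using qf_lyap[OF X, where M = A and x = x] by (simp add: lyap_def)
    moreover have "qf (B ** Y) x = (x v* B) \<bullet> (Y *v x)" "qf (transpose Y ** transpose B) x = (x v* B) \<bullet> (Y *v x)"
      by (simp_all add: matrix_vector_mul_assoc [symmetric] dot_lmul_matrix dot_transpose inner_commute[of _ x])
    ultimately show ?thesis by (simp only: qf_add)
  qed
  moreover have "x \<bullet> ((X ** ?Q) *v y) = y \<bullet> (?Q *v (X *v x))"
    using symmetric_dot[OF X, of x "?Q *v y"] symmetric_dot[OF sQ, of "X *v x" y]
    by (simp add: matrix_vector_mul_assoc [symmetric] inner_commute)
  moreover have "x \<bullet> ((transpose Y ** ?R) *v w) = w \<bullet> (?R *v (Y *v x))"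
    using symmetric_dot[OF sR, of "Y *v x" w]
    by (simp add: matrix_vector_mul_assoc [symmetric] dot_transpose)
  ultimately show ?thesis
    by (simp add: inner_add_right inner_diff_right matrix_vector_mul_assoc [symmetric])
qed

lemma transpose_eq_entry: "transpose N = P \<Longrightarrow> N $ a $ b = P $ b $ a"
  by (auto simp: transpose_def)

lemma Fcvx_mat_sym:
  assumes X: "transpose X = X" and Q: "pd Q" and R: "pd R"
  shows "transpose (Fcvx_mat A B Bw Q R \<beta> X Y) = Fcvx_mat A B Bw Q R \<beta> X Y"
proof -
  let ?M = "A ** X + X ** transpose A + B ** Y + transpose Y ** transpose B + Bw ** transpose Bw"
  have sQ: "transpose (msqrt Q) = msqrt Q" and sR: "transpose (msqrt R) = msqrt R"
    using msqrt_props(1) Q R psd_sym by blast+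
  have t: "transpose ?M = ?M" "transpose (X ** msqrt Q) = msqrt Q ** X"
      "transpose (transpose Y ** msqrt R) = msqrt R ** Y"
    by (simp_all add: mat_distribs matrix_transpose_mul X sQ sR algebra_simps)
  have "?M $ a $ b = ?M $ b $ a" "(X ** msqrt Q) $ a $ b = (msqrt Q ** X) $ b $ a"
    "(transpose Y ** msqrt R) $ a $ c = (msqrt R ** Y) $ c $ a" for a b c
    by (rule transpose_eq_entry, rule t)+
  then show ?thesis
    unfolding Fcvx_mat_def Let_def transpose_def vec_eq_iff
    by (auto split: sum.split)
qed

lemma young_scaled:
  fixes y p :: "'a::real_inner"
  assumes "\<beta> > 0"
  shows "2 * (y \<bullet> p) - \<beta>\<^sup>2 * (y \<bullet> y) \<le> inverse (\<beta>\<^sup>2) * (p \<bullet> p)"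
proof -
  have "0 \<le> (\<beta> *\<^sub>R y - inverse \<beta> *\<^sub>R p) \<bullet> (\<beta> *\<^sub>R y - inverse \<beta> *\<^sub>R p)" by simp
  also have "\<dots> = \<beta>\<^sup>2 * (y \<bullet> y) - 2 * (y \<bullet> p) + inverse (\<beta>\<^sup>2) * (p \<bullet> p)"
    using assms by (simp add: inner_diff_left inner_diff_right inner_commute[of p y] power2_eq_square field_simps)
  finally show ?thesis by simp
qed

context hinf_design
begin

text \<open>For fixed x the block form is concave in the other two components, and its maximum over
  them is the Riccati form at x.\<close>

lemma schur_complement:
  fixes K :: "real^'n^'m"
  assumes X: "transpose X = X"
  shows "nsd (Fcvx_mat A B Bw Q R \<beta> X (K ** X)) \<longleftrightarrow> psd (- ric A B Bw Q R \<beta> K X)"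
proof
  let ?F = "Fcvx_mat A B Bw Q R \<beta> X (K ** X)" and ?b = "inverse (\<beta>\<^sup>2)"
  let ?p = "\<lambda>x. msqrt Q *v (X *v x)" and ?q = "\<lambda>x. msqrt R *v ((K ** X) *v x)"
  note F = Fcvx_mat_qf[OF X Q R, of _ A B Bw \<beta> "K ** X"]
  have ric: "qf (ric A B Bw Q R \<beta> K X) x =
    2 * ((x v* A) \<bullet> (X *v x)) + 2 * ((x v* B) \<bullet> ((K ** X) *v x)) + qf (Bw ** transpose Bw) x
    + ?b * (?p x \<bullet> ?p x) + ?b * (?q x \<bullet> ?q x)" for x
    unfolding qf_ric[OF X] msqrt_norm[OF Q] msqrt_norm[OF R] by (simp add: distrib_left)
  {
    assume "nsd ?F"
    then have F0: "qf ?F z \<le> 0" for z unfolding nsd_def using psd_qf[of "- ?F" z] by (simp add: qf_minus)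
    have "qf (ric A B Bw Q R \<beta> K X) x \<le> 0" for x
    proof -
      \<comment> \<open>These components attain the maximum: they are the equality case of
        \<open>young_scaled\<close>.\<close>
      define z :: "real^('n + ('n + 'm))" where "z = (\<chi> i. case i of Inl a \<Rightarrow> x $ a
        | Inr (Inl a) \<Rightarrow> (?b *\<^sub>R ?p x) $ a | Inr (Inr a) \<Rightarrow> (?b *\<^sub>R ?q x) $ a)"
      have z: "(\<chi> i. z $ Inl i) = x" "(\<chi> i. z $ Inr (Inl i)) = ?b *\<^sub>R ?p x" "(\<chi> i. z $ Inr (Inr i)) = ?b *\<^sub>R ?q x"
        by (simp_all add: z_def vec_eq_iff)
      have cancel: "\<beta>\<^sup>2 * (?b * (?b * c)) = ?b * c" for c using \<beta> by (simp add: field_simps)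
      have "qf ?F z = qf (ric A B Bw Q R \<beta> K X) x"
        unfolding F z ric inner_scaleR_left inner_scaleR_right cancel by linarith
      then show ?thesis using F0[of z] by simp
    qed
    then show "psd (- ric A B Bw Q R \<beta> K X)"
      using transpose_ric[OF X pd_sym[OF Q] pd_sym[OF R], of A B Bw \<beta> K]
      by (simp add: psd_def transpose_minus qf_minus)
  }
  assume sub: "psd (- ric A B Bw Q R \<beta> K X)"
  have "qf ?F z \<le> 0" for z
  proof -
    define x y w where "x = (\<chi> i. z $ Inl i)" and "y = (\<chi> i. z $ Inr (Inl i))" and "w = (\<chi> i. z $ Inr (Inr i))"
    have "qf ?F z \<le> qf (ric A B Bw Q R \<beta> K X) x"
      unfolding F ric x_def [symmetric] y_def [symmetric] w_def [symmetric]
      using young_scaled[OF \<beta>, of y "?p x"] young_scaled[OF \<beta>, of w "?q x"] by linarith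
    also have "\<dots> \<le> 0" using psd_qf[OF sub, of x] by (simp add: qf_minus)
    finally show ?thesis .
  qed
  then show "nsd ?F"
    using Fcvx_mat_sym[OF X Q R, of A B Bw \<beta> "K ** X"]
    by (simp add: nsd_def psd_def transpose_minus qf_minus)
qed

lemma Fcvx_iff:
  assumes X: "pd X"
  shows "(\<gamma>, X, K ** X) \<in> Fcvx A B Bw Q R \<beta> Q2 R2 \<longleftrightarrow> (K, \<gamma>, X) \<in> Llft A B Bw Q R \<beta> Q2 R2"
proof -
  have "det X \<noteq> 0" using pd_imp_invertible[OF X] invertible_det_nz by blast
  then have "R2 ** (K ** X) ** matrix_inv X ** transpose (K ** X) = R2 ** K ** X ** transpose K"
    using matrix_inv_cancel(1)[of X] pd_sym[OF X]
    by (metis matrix_mul_assoc matrix_mul_rid matrix_transpose_mul)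
  then show ?thesis
    using X schur_complement[OF pd_sym[OF X], of K] by (auto simp: Fcvx_def Llft_def nsd_def)
qed

lemma lift_diffeo:
  "smooth_diffeo (\<lambda>(K, \<gamma>, X). (\<gamma>, X, K ** X)) (Llft A B Bw Q R \<beta> Q2 R2) (Fcvx A B Bw Q R \<beta> Q2 R2)"
proof -
  let ?L = "Llft A B Bw Q R \<beta> Q2 R2" and ?F = "Fcvx A B Bw Q R \<beta> Q2 R2"
  let ?\<Phi> = "\<lambda>(K :: real^'n^'m, \<gamma> :: real, X :: real^'n^'n). (\<gamma>, X, K ** X)"
  let ?\<Psi> = "\<lambda>(\<gamma> :: real, X :: real^'n^'n, Y :: real^'n^'m). (Y ** matrix_inv X, \<gamma>, X)"
  have det: "det X \<noteq> 0" if "pd X" for X :: "real^'n^'n"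
    using pd_imp_invertible[OF that] invertible_det_nz by blast
  have pL: "pd X" if "(K, \<gamma>, X) \<in> ?L" for K \<gamma> X using that by (simp add: Llft_def)
  have pF: "pd X" if "(\<gamma>, X, Y) \<in> ?F" for \<gamma> X Y using that by (simp add: Fcvx_def)
  have left: "?\<Psi> (?\<Phi> p) = p" if "p \<in> ?L" for p
  proof -
    obtain K \<gamma> X where p: "p = (K, \<gamma>, X)" by (rule prod_cases3)
    show ?thesis using matrix_inv_cancel(1)[OF det[OF pL[OF that[unfolded p]]]]
      by (simp add: p matrix_mul_assoc [symmetric])
  qed
  have right: "?\<Phi> (?\<Psi> q) = q \<and> ?\<Psi> q \<in> ?L" if "q \<in> ?F" for q
  proof -
    obtain \<gamma> X Y where q: "q = (\<gamma>, X, Y)" by (rule prod_cases3)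
    have X: "pd X" using pF that unfolding q .
    have "Y ** matrix_inv X ** X = Y"
      using matrix_inv_cancel(2)[OF det[OF X]] by (simp add: matrix_mul_assoc [symmetric])
    then show ?thesis using that Fcvx_iff[OF X, of \<gamma> "Y ** matrix_inv X"] by (simp add: q)
  qed
  have into: "?\<Phi> p \<in> ?F" if "p \<in> ?L" for p
  proof -
    obtain K \<gamma> X where p: "p = (K, \<gamma>, X)" by (rule prod_cases3)
    show ?thesis using that Fcvx_iff[OF pL[OF that[unfolded p]], of \<gamma> K] by (simp add: p)
  qed
  have bij: "bij_betw ?\<Phi> ?L ?F"
    using left right into by (intro bij_betw_byWitness[where f' = ?\<Psi>]) auto
  have inv: "inv_into ?L ?\<Phi> q = ?\<Psi> q" if "q \<in> ?F" for q
    using inv_into_f_f[OF bij_betw_imp_inj_on[OF bij], of "?\<Psi> q"] right[OF that] by metis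
  have lin: "bounded_linear (\<lambda>p. fst (snd p))" "bounded_linear (\<lambda>p. snd (snd p))"
    by (rule bounded_linear_compose[OF bounded_linear_fst bounded_linear_snd]
        bounded_linear_compose[OF bounded_linear_snd bounded_linear_snd])+
  have "smooth_ext ?L ?\<Phi>"
    unfolding smooth_ext_def smooth_on_def
  proof (intro exI conjI allI ballI)
    \<comment> \<open>The map is polynomial, so it is its own smooth extension to the whole
      space.\<close>
    show "Ck k UNIV ?\<Phi>" for k
      unfolding case_prod_beta'
      by (intro Ck_Pair Ck_bilinear[OF _ bounded_bilinear_matrix_mul] Ck_bounded_linear lin
          bounded_linear_fst open_UNIV)
  qed auto
  moreover have "smooth_ext ?F (inv_into ?L ?\<Phi>)"
    unfolding smooth_ext_def smooth_on_def
  proof (intro exI conjI allI ballI)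
    \<comment> \<open>\<open>pd\<close> includes symmetry, so the positive definite matrices are not
      open among all matrices in general. The inverse map extends to the open set where X is
      invertible.\<close>
    let ?U = "{p :: real \<times> (real^'n^'n) \<times> (real^'n^'m). det (fst (snd p)) \<noteq> 0}"
    show U: "open ?U" by (intro open_Collect_neq continuous_on_det continuous_intros)
    show "?F \<subseteq> ?U" using pF det by auto
    show "Ck k ?U ?\<Psi>" for k
      unfolding case_prod_beta'
      by (intro Ck_Pair Ck_bilinear[OF _ bounded_bilinear_matrix_mul] Ck_matrix_inv Ck_bounded_linear lin
          bounded_linear_fst U) simp
    show "?\<Psi> q = inv_into ?L ?\<Phi> q" if "q \<in> ?F" for q using inv[OF that] by simp
  qed
  ultimately show ?thesis using bij unfolding smooth_diffeo_def by blast
qed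

end

theorem theorem6:
  fixes A :: "real^'n^'n" and B :: "real^'m^'n" and Bw :: "real^'n^'n"
    and Q2 :: "real^'n^'n" and R2 :: "real^'m^'m"
    and Qinf :: "real^'n^'n" and Rinf :: "real^'m^'m" and \<beta> :: real
  assumes beta_pos: "\<beta> > 0"
    and Q2_psd: "psd Q2" and R2_pd: "pd R2" and Qinf_pd: "pd Qinf" and Rinf_pd: "pd Rinf"
    and W_pd: "pd (Bw ** transpose Bw)"
    and stabilizable: "\<exists>K::real^'n^'m. hurwitz (A + B ** K)"
    and detectable: "\<exists>L::real^'n^'n. hurwitz (A + L ** msqrt Q2)"
    and beta_feasible: "\<beta> > Inf (hinf_norm A B Bw Qinf Rinf ` Kstab A B)"
  shows "epi_Jmix A B Bw Qinf Rinf \<beta> Q2 R2 \<subseteq> proj_Kgamma (Llft A B Bw Qinf Rinf \<beta> Q2 R2)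
       \<and> proj_Kgamma (Llft A B Bw Qinf Rinf \<beta> Q2 R2) = closure (epi_Jmix A B Bw Qinf Rinf \<beta> Q2 R2)
       \<and> smooth_diffeo (\<lambda>(K, \<gamma>, X). (\<gamma>, X, K ** X))
           (Llft A B Bw Qinf Rinf \<beta> Q2 R2) (Fcvx A B Bw Qinf Rinf \<beta> Q2 R2)"
proof -
  interpret hinf_design A B Bw Qinf Rinf \<beta>
    using beta_pos Qinf_pd Rinf_pd W_pd by unfold_locales
  have "hinf_norm A B Bw Qinf Rinf ` Kstab A B \<noteq> {}"
    using stabilizable by (auto simp: Kstab_def AK_def)
  then obtain K where "K \<in> Kstab A B" "hinf_norm A B Bw Qinf Rinf K < \<beta>"
    using cInf_lessD[OF _ beta_feasible] by blast
  then have "Kbeta A B Bw Qinf Rinf \<beta> \<noteq> {}" by (auto simp: Kbeta_def)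
  then show ?thesis
    using epi_subset_proj proj_eq_closure[OF Q2_psd R2_pd] lift_diffeo by blast
qed

end
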